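(* Let $A$ be an $(n\times N)$-matrix of rank $n$ with integer entries $w_{ij}$ and columns $\mathbf w_1,\ldots,\mathbf w_N\in\mathbb Z^n$, and let $\boldsymbol\gamma\in\mathbb C^n$. There is an isomorphism of $\mathcal D_{\mathbb A^N}$-modules $$\varinjlim_{\mathbf v\in\delta\cap\mathbb Z^n}\mathcal H_{\boldsymbol\gamma+\mathbf v}\cong\mathcal H^n(\mathcal C^\cdot_{\boldsymbol\gamma}).$$
   Context: All varieties are over $\mathbb C$. Write $\mathbf t=(t_1,\ldots,t_n)$ for the coordinates on $\mathbb G_m^n$, $\mathbf x=(x_1,\ldots,x_N)$ for those on $\mathbb A^N$, and $\mathbf t^{\mathbf w}=t_1^{w_1}\cdots t_n^{w_n}$ for $\mathbf w\in\mathbb Z^n$. For $\boldsymbol\beta\in\mathbb C^n$, the $A$-hypergeometric $\mathcal D$-module is $$\mathcal H_{\boldsymbol\beta}=\mathcal D_{\mathbb A^N}\Big/\mathcal D_{\mathbb A^N}\Big(\sum_{j=1}^N w_{ij}x_j\partial_{x_j}+\beta_i\ (1\le i\le n),\ \square_{\boldsymbol\lambda}\Big),\qquad \square_{\boldsymbol\lambda}=\prod_{\lambda_j>0}\partial_{x_j}^{\lambda_j}-\prod_{\lambda_j<0}\partial_{x_j}^{-\lambda_j},$$ where $\boldsymbol\lambda$ runs over all elements of $\mathbb Z^N$ with $\sum_{j=1}^N\lambda_j\mathbf w_j=0$. $\delta=\{c_1\mathbf w_1+\cdots+c_N\mathbf w_N: c_1,\ldots,c_N\in\mathbb R_{\ge0}\}$.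 The index set $\delta\cap\mathbb Z^n$ is ordered by: $\mathbf v^{(1)}\le\mathbf v^{(2)}$ if and only if $\mathbf v^{(1)}-\mathbf v^{(2)}=a_1\mathbf w_1+\cdots+a_N\mathbf w_N$ for some nonnegative integers $a_j$. The transition morphisms of the direct system $(\mathcal H_{\boldsymbol\gamma+\mathbf v})_{\mathbf v\in\delta\cap\mathbb Z^n}$ are the composites of the morphisms $\cdot\partial_{x_k}:\mathcal H_{\boldsymbol\gamma+\mathbf v+\mathbf w_k}\to\mathcal H_{\boldsymbol\gamma+\mathbf v}$ induced by right multiplication $P\mapsto P\partial_{x_k}$ on $\mathcal D_{\mathbb A^N}$; so for $\mathbf v^{(1)}-\mathbf v^{(2)}=\sum_ja_j\mathbf w_j$ the morphism $\mathcal H_{\boldsymbol\gamma+\mathbf v^{(1)}}\to\mathcal H_{\boldsymbol\gamma+\mathbf v^{(2)}}$ is induced by right multiplication by $\prod_j\partial_{x_j}^{a_j}$ (independent of the choice of the $a_j$ because of the relations $\square_{\boldsymbol\lambda}$). The index set is not necessarily directed; $\varinjlim$ denotes the colimit in the category of $\mathcal D_{\mathbb A^N}$-modules. $\mathbb C[\delta\cap\mathbb Z^n]$ is the subring of $\mathbb C[\mathbf t^{\pm1}]$ generated by the monomials $\mathbf t^{\mathbf w}$, $\mathbf w\in\delta\cap\mathbb Z^n$; $q_2:\mathrm{Spec}\,\mathbb C[\delta\cap\mathbb Z^n]\times\mathbb A^N\to\mathbb A^N$ is the projection. $\mathcal C^\cdot_{\boldsymbol\gamma}$ is the complex of $\mathcal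 D_{\mathbb A^N}$-modules with $$\mathcal C^q_{\boldsymbol\gamma}=\bigoplus_{1\le i_1<\cdots<i_q\le n}q_{2*}\mathcal O_{\mathrm{Spec}\,\mathbb C[\delta\cap\mathbb Z^n]\times\mathbb A^N}\,\frac{\mathrm dt_{i_1}}{t_{i_1}}\wedge\cdots\wedge\frac{\mathrm dt_{i_q}}{t_{i_q}},$$ with differential $$d\Big(h\frac{\mathrm dt_{i_1}}{t_{i_1}}\wedge\cdots\wedge\frac{\mathrm dt_{i_q}}{t_{i_q}}\Big)=\sum_{i=1}^n\Big(t_i\frac{\partial h}{\partial t_i}+\gamma_ih+\sum_{j=1}^N w_{ij}x_j\mathbf t^{\mathbf w_j}h\Big)\frac{\mathrm dt_i}{t_i}\wedge\frac{\mathrm dt_{i_1}}{t_{i_1}}\wedge\cdots\wedge\frac{\mathrm dt_{i_q}}{t_{i_q}},$$ and with $\partial_{x_j}$ acting on coefficients by $h\mapsto\frac{\partial h}{\partial x_j}+\mathbf t^{\mathbf w_j}h$. *)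

theory Defs
  imports "HOL-Analysis.Analysis" "HOL-Algebra.AbelCoset" "HOL-Algebra.Module"
    "HOL-Library.Poly_Mapping"
begin

section \<open>Left modules, quotients and colimits\<close>

text \<open>The library's locale \<open>module\<close> requires a commutative ring. The record type
  \<open>module\<close> (whose fields \<open>mult\<close> and \<open>one\<close> are ignored) and the predicate \<open>submodule\<close> do not.\<close>

locale left_module = R?: ring R + M?: abelian_group M for R (structure) and M (structure) +
  assumes smult_closed:
      "\<lbrakk>a \<in> carrier R; x \<in> carrier M\<rbrakk> \<Longrightarrow> a \<odot>\<^bsub>M\<^esub> x \<in> carrier M"
    and smult_l_distr:
      "\<lbrakk>a \<in> carrier R; b \<in> carrier R; x \<in> carrier M\<rbrakk> \<Longrightarrow>
        (a \<oplus> b) \<odot>\<^bsub>M\<^esub> x = a \<odot>\<^bsub>M\<^esub> x \<oplus>\<^bsub>M\<^esub> b \<odot>\<^bsub>M\<^esub> x"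
    and smult_r_distr:
      "\<lbrakk>a \<in> carrier R; x \<in> carrier M; y \<in> carrier M\<rbrakk> \<Longrightarrow>
        a \<odot>\<^bsub>M\<^esub> (x \<oplus>\<^bsub>M\<^esub> y) = a \<odot>\<^bsub>M\<^esub> x \<oplus>\<^bsub>M\<^esub> a \<odot>\<^bsub>M\<^esub> y"
    and smult_assoc:
      "\<lbrakk>a \<in> carrier R; b \<in> carrier R; x \<in> carrier M\<rbrakk> \<Longrightarrow>
        (a \<otimes> b) \<odot>\<^bsub>M\<^esub> x = a \<odot>\<^bsub>M\<^esub> (b \<odot>\<^bsub>M\<^esub> x)"
    and smult_one: "x \<in> carrier M \<Longrightarrow> \<one> \<odot>\<^bsub>M\<^esub> x = x"

definition module_hom ::
  "('r, 'e) ring_scheme \<Rightarrow> ('r, 'a, 'f) module_scheme \<Rightarrow> ('r, 'b, 'g) module_scheme \<Rightarrow> ('a \<Rightarrow> 'b) set"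
  where "module_hom R M L = {h. h \<in> carrier M \<rightarrow> carrier L \<and>
    (\<forall>x\<in>carrier M. \<forall>y\<in>carrier M. h (x \<oplus>\<^bsub>M\<^esub> y) = h x \<oplus>\<^bsub>L\<^esub> h y) \<and>
    (\<forall>r\<in>carrier R. \<forall>x\<in>carrier M. h (r \<odot>\<^bsub>M\<^esub> x) = r \<odot>\<^bsub>L\<^esub> h x)}"

definition module_isomorphic ::
  "('r, 'e) ring_scheme \<Rightarrow> ('r, 'a, 'f) module_scheme \<Rightarrow> ('r, 'b, 'g) module_scheme \<Rightarrow> bool"
  where "module_isomorphic R M L \<longleftrightarrow> left_module R M \<and> left_module R L \<and>
    (\<exists>h\<in>module_hom R M L. bij_betw h (carrier M) (carrier L))"

definition submodule_span ::
  "('r, 'e) ring_scheme \<Rightarrow> ('r, 'a) module \<Rightarrow> 'a set \<Rightarrow> 'a set"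
  where "submodule_span R M S = \<Inter>{K. submodule K R M \<and> S \<subseteq> K}"

text \<open>The map into \<open>M / K\<close> induced by a map \<open>f\<close> into \<open>M\<close>, the argument being a coset;
  the union is over equal cosets whenever the induced map is well defined.\<close>

definition coset_map :: "('r, 'b) module \<Rightarrow> 'b set \<Rightarrow> ('a \<Rightarrow> 'b) \<Rightarrow> 'a set \<Rightarrow> 'b set"
  where "coset_map M K f X = (\<Union>x\<in>X. K +>\<^bsub>M\<^esub> f x)"

definition quotient_module :: "('r, 'a) module \<Rightarrow> 'a set \<Rightarrow> ('r, 'a set) module"
  where "quotient_module M K =
    \<lparr>carrier = a_rcosets\<^bsub>M\<^esub> K, mult = undefined, one = undefined,
     zero = K, add = (<+>\<^bsub>M\<^esub>), smult = (\<lambda>r. coset_map M K (smult M r))\<rparr>"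

definition direct_sum :: "'i set \<Rightarrow> ('i \<Rightarrow> ('r, 'a) module) \<Rightarrow> ('r, 'i \<Rightarrow> 'a) module"
  where "direct_sum I M =
    \<lparr>carrier = {f \<in> (\<Pi>\<^sub>E i\<in>I. carrier (M i)). finite {i \<in> I. f i \<noteq> \<zero>\<^bsub>M i\<^esub>}},
     mult = undefined, one = undefined,
     zero = (\<lambda>i\<in>I. \<zero>\<^bsub>M i\<^esub>), add = (\<lambda>f g. \<lambda>i\<in>I. f i \<oplus>\<^bsub>M i\<^esub> g i),
     smult = (\<lambda>r f. \<lambda>i\<in>I. r \<odot>\<^bsub>M i\<^esub> f i)\<rparr>"

definition direct_sum_inj :: "'i set \<Rightarrow> ('i \<Rightarrow> ('r, 'a) module) \<Rightarrow> 'i \<Rightarrow> 'a \<Rightarrow> 'i \<Rightarrow> 'a"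
  where "direct_sum_inj I M i x = (\<lambda>k\<in>I. if k = i then x else \<zero>\<^bsub>M k\<^esub>)"

text \<open>Colimit in the category of \<open>R\<close>-modules, constructed as the direct sum modulo the
  identifications \<open>x \<sim> \<phi> i j x\<close>, of a diagram over a preordered set, with transition maps
  \<open>\<phi> i j : M i \<rightarrow> M j\<close> for \<open>prec i j\<close>; the index set need not be directed.\<close>

definition colimit_relations ::
  "('r, 'e) ring_scheme \<Rightarrow> 'i set \<Rightarrow> ('i \<Rightarrow> 'i \<Rightarrow> bool) \<Rightarrow> ('i \<Rightarrow> ('r, 'a) module) \<Rightarrow>
    ('i \<Rightarrow> 'i \<Rightarrow> 'a \<Rightarrow> 'a) \<Rightarrow> ('i \<Rightarrow> 'a) set"
  where "colimit_relations R I prec M \<phi> = submodule_span R (direct_sum I M)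
    {direct_sum_inj I M i x \<ominus>\<^bsub>direct_sum I M\<^esub> direct_sum_inj I M j (\<phi> i j x) | i j x.
      i \<in> I \<and> j \<in> I \<and> prec i j \<and> x \<in> carrier (M i)}"

definition colimit ::
  "('r, 'e) ring_scheme \<Rightarrow> 'i set \<Rightarrow> ('i \<Rightarrow> 'i \<Rightarrow> bool) \<Rightarrow> ('i \<Rightarrow> ('r, 'a) module) \<Rightarrow>
    ('i \<Rightarrow> 'i \<Rightarrow> 'a \<Rightarrow> 'a) \<Rightarrow> ('r, ('i \<Rightarrow> 'a) set) module"
  where "colimit R I prec M \<phi> =
    quotient_module (direct_sum I M) (colimit_relations R I prec M \<phi>)"

text \<open>Cohomology of a complex \<open>C 0 \<rightarrow> C 1 \<rightarrow> \<dots>\<close> all of whose differentials are given by \<open>d\<close>.\<close>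

definition cohomology :: "(nat \<Rightarrow> ('r, 'a) module) \<Rightarrow> ('a \<Rightarrow> 'a) \<Rightarrow> nat \<Rightarrow> ('r, 'a set) module"
  where "cohomology C d q =
    quotient_module ((C q)\<lparr>carrier := {\<omega> \<in> carrier (C q). d \<omega> = \<zero>\<^bsub>C (Suc q)\<^esub>}\<rparr>)
      (case q of 0 \<Rightarrow> {\<zero>\<^bsub>C 0\<^esub>} | Suc p \<Rightarrow> d ` carrier (C p))"


section \<open>The Weyl algebra\<close>

text \<open>\<open>('N, 'k) pol\<close> is the polynomial ring in the variables \<open>x\<^sub>j\<close> over the monoid algebra of \<open>'k\<close>:
  over the Laurent polynomials in \<open>t\<close> for \<open>'k = int ^ 'n\<close>, and over \<open>\<complex>[\<xi>]\<close> for \<open>'k = nat ^ 'N\<close>.\<close>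

type_synonym ('N, 'k) pol = "(nat, 'N) vec \<Rightarrow>\<^sub>0 ('k \<Rightarrow>\<^sub>0 complex)"

definition pmonom :: "(nat, 'N::finite) vec \<Rightarrow> 'k \<Rightarrow> complex \<Rightarrow> ('N, 'k) pol"
  where "pmonom a k c = Poly_Mapping.single a (Poly_Mapping.single k c)"

definition pol_coeff :: "('N, 'k) pol \<Rightarrow> (nat, 'N) vec \<Rightarrow> 'k \<Rightarrow> complex"
  where "pol_coeff h a k = Poly_Mapping.lookup (Poly_Mapping.lookup h a) k"

text \<open>Application of a function on monomials to every term of \<open>h\<close>.\<close>

definition map_terms ::
  "((nat, 'N) vec \<Rightarrow> 'k \<Rightarrow> complex \<Rightarrow> 'm::comm_monoid_add) \<Rightarrow> ('N, 'k) pol \<Rightarrow> 'm"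
  where "map_terms F h =
    (\<Sum>a\<in>Poly_Mapping.keys h. \<Sum>k\<in>Poly_Mapping.keys (Poly_Mapping.lookup h a).
      F a k (pol_coeff h a k))"

definition partial_x :: "'N::finite \<Rightarrow> ('N, 'k) pol \<Rightarrow> ('N, 'k) pol"
  where "partial_x j = map_terms (\<lambda>a k c. pmonom (a - axis j 1) k (of_nat (a $ j) * c))"

text \<open>The operator \<open>h \<mapsto> \<partial>h/\<partial>x\<^sub>j + y\<^sub>j h\<close>, where \<open>y\<^sub>j\<close> is the monomial with exponent \<open>y j\<close>,
  and the resulting action \<open>(\<Sum> c\<^sub>a\<^sub>b x\<^sup>a \<partial>\<^sup>b) h = \<Sum> c\<^sub>a\<^sub>b x\<^sup>a \<nabla>\<^sup>b h\<close> of differential operators in normal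
  form. The \<open>\<nabla>\<^sub>j\<close> commute (\<open>nabla_commute\<close> below), so their order is irrelevant.\<close>

definition nabla ::
  "('N::finite \<Rightarrow> 'k::comm_monoid_add) \<Rightarrow> 'N \<Rightarrow> ('N, 'k) pol \<Rightarrow> ('N, 'k) pol"
  where "nabla y j h = partial_x j h + pmonom 0 (y j) 1 * h"

definition nabla_power ::
  "('N::{finite,linorder} \<Rightarrow> 'k::comm_monoid_add) \<Rightarrow> (nat, 'N) vec \<Rightarrow> ('N, 'k) pol \<Rightarrow> ('N, 'k) pol"
  where "nabla_power y b = foldr (\<lambda>j. nabla y j ^^ (b $ j)) (sorted_list_of_set UNIV)"

text \<open>An operator \<open>\<Sum> c\<^sub>a\<^sub>b x\<^sup>a \<partial>\<^sup>b\<close> with polynomial coefficients is represented by its symbol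
  \<open>\<Sum> c\<^sub>a\<^sub>b x\<^sup>a \<xi>\<^sup>b\<close>. The product \<open>*\<close> of the type is the commutative product of symbols, not
  composition of operators.\<close>

type_synonym 'N diff_op = "('N, (nat, 'N) vec) pol"

definition act ::
  "('N::{finite,linorder} \<Rightarrow> 'k::comm_monoid_add) \<Rightarrow> 'N diff_op \<Rightarrow> ('N, 'k) pol \<Rightarrow> ('N, 'k) pol"
  where "act y P h = map_terms (\<lambda>a b c. pmonom a 0 c * nabla_power y b h) P"

text \<open>Composition: on symbols, left multiplication by \<open>x\<^sub>j\<close> is multiplication by \<open>x\<^sub>j\<close>, and left
  multiplication by \<open>\<partial>\<^sub>j\<close> is \<open>\<partial>/\<partial>x\<^sub>j + \<xi>\<^sub>j\<close> because \<open>\<partial>\<^sub>j x\<^sup>a \<partial>\<^sup>b = a\<^sub>j x\<^sup>a\<^sup>-\<^sup>e\<^sup>j \<partial>\<^sup>b + x\<^sup>a \<partial>\<^sup>b\<^sup>+\<^sup>e\<^sup>j\<close>.\<close>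

definition weyl_mult ::
  "'N::{finite,linorder} diff_op \<Rightarrow> 'N diff_op \<Rightarrow> 'N diff_op"  (infixl \<open>\<star>\<close> 70)
  where "P \<star> Q = act (\<lambda>j. axis j 1) P Q"

definition weyl_algebra :: "'N::{finite,linorder} diff_op ring"
  where "weyl_algebra = \<lparr>carrier = UNIV, mult = (\<star>), one = 1, zero = 0, add = (+)\<rparr>"

definition weyl_module :: "('N::{finite,linorder} diff_op, 'N diff_op) module"
  where "weyl_module =
    \<lparr>carrier = UNIV, mult = (\<star>), one = 1, zero = 0, add = (+), smult = (\<star>)\<rparr>"

definition scalar_op :: "complex \<Rightarrow> 'N::finite diff_op"
  where "scalar_op c = pmonom 0 0 c"

definition x_op :: "'N::finite \<Rightarrow> 'N diff_op"
  where "x_op j = pmonom (axis j 1) 0 1"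

definition d_power :: "(nat, 'N::finite) vec \<Rightarrow> 'N diff_op"
  where "d_power b = pmonom 0 b 1"

definition d_op :: "'N::finite \<Rightarrow> 'N diff_op"
  where "d_op j = d_power (axis j 1)"


text \<open>The following facts justify the definitions: \<open>\<star>\<close> makes the symbols a ring satisfying the
  Weyl relations in which the symbol \<open>x\<^sup>a \<xi>\<^sup>b\<close> is the product \<open>x\<^sup>a \<star> \<partial>\<^sup>b\<close>, and \<open>act\<close> is an action of this ring.\<close>

declare One_nat_def [simp del]

lemma poly_mapping_sum_monomials: "(\<Sum>a\<in>Poly_Mapping.keys h. Poly_Mapping.single a (Poly_Mapping.lookup h a)) = h"
  by (rule poly_mapping_eqI) (simp add: lookup_sum lookup_single when_def in_keys_iff)

lemma pmonom_0 [simp]: "pmonom a k 0 = 0" by (simp add: pmonom_def)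

lemma pmonom_add: "pmonom a k (c + d) = pmonom a k c + pmonom a k d"
  by (simp add: pmonom_def single_add)

lemma pmonom_mult: "pmonom a k c * pmonom b l d = pmonom (a + b) (k + l) (c * d)"
  by (simp add: pmonom_def mult_single)

lemma pmonom_one: "pmonom 0 0 1 = 1" by (simp add: pmonom_def)

lemma map_terms_superset:
  assumes "\<And>a k. F a k 0 = 0" "finite S" "finite T" "Poly_Mapping.keys h \<subseteq> S"
    "\<And>a. Poly_Mapping.keys (Poly_Mapping.lookup h a) \<subseteq> T"
  shows "map_terms F h = (\<Sum>a\<in>S. \<Sum>k\<in>T. F a k (pol_coeff h a k))"
proof -
  have "(\<Sum>k\<in>Poly_Mapping.keys (Poly_Mapping.lookup h a). F a k (pol_coeff h a k)) = (\<Sum>k\<in>T. F a k (pol_coeff h a k))" for a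
    by (intro sum.mono_neutral_left) (use assms in \<open>auto simp: pol_coeff_def in_keys_iff\<close>)
  moreover have "(\<Sum>a\<in>Poly_Mapping.keys h. \<Sum>k\<in>T. F a k (pol_coeff h a k)) = (\<Sum>a\<in>S. \<Sum>k\<in>T. F a k (pol_coeff h a k))"
    by (intro sum.mono_neutral_left) (use assms in \<open>auto simp: pol_coeff_def in_keys_iff\<close>)
  ultimately show ?thesis by (simp add: map_terms_def)
qed

definition inner_keys :: "('N::finite, 'k) pol \<Rightarrow> 'k set" where
  "inner_keys h = (\<Union>a\<in>Poly_Mapping.keys h. Poly_Mapping.keys (Poly_Mapping.lookup h a))"

lemma inner_keys: "finite (inner_keys h)" "Poly_Mapping.keys (Poly_Mapping.lookup h a) \<subseteq> inner_keys h"
  unfolding inner_keys_def by (auto simp: in_keys_iff) (metis lookup_zero in_keys_iff)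

lemma map_terms_add:
  fixes p q :: "('N::finite, 'k) pol"
  assumes F0: "\<And>a k. F a k 0 = 0" and "\<And>a k c d. F a k (c + d) = F a k c + F a k d"
  shows "map_terms F (p + q) = map_terms F p + map_terms F q"
proof -
  let ?S = "Poly_Mapping.keys p \<union> Poly_Mapping.keys q"
  let ?T = "inner_keys p \<union> inner_keys q"
  note s = map_terms_superset[where S="?S" and T="?T" and F=F, OF F0]
  have "Poly_Mapping.keys (Poly_Mapping.lookup (p+q) a) \<subseteq> ?T" for a
    using inner_keys(2)[of p a] inner_keys(2)[of q a]
    using Poly_Mapping.keys_add[of "Poly_Mapping.lookup p a" "Poly_Mapping.lookup q a"] by (auto simp: lookup_add)
  then have "map_terms F (p+q) = (\<Sum>a\<in>?S. \<Sum>k\<in>?T. F a k (pol_coeff (p+q) a k))"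
    using Poly_Mapping.keys_add[of p q] by (intro s) (auto simp: inner_keys)
  moreover have "map_terms F p = (\<Sum>a\<in>?S. \<Sum>k\<in>?T. F a k (pol_coeff p a k))"
    by (intro s) (use inner_keys(2)[of p] inner_keys(1) in auto)
  moreover have "map_terms F q = (\<Sum>a\<in>?S. \<Sum>k\<in>?T. F a k (pol_coeff q a k))"
    by (intro s) (use inner_keys(2)[of q] inner_keys(1) in auto)
  ultimately show ?thesis
    by (simp add: pol_coeff_def lookup_add assms sum.distrib)
qed

lemma map_terms_monom [simp]:
  fixes a :: "(nat, 'N::finite) vec"
  assumes "\<And>a k. F a k 0 = 0"
  shows "map_terms F (pmonom a k c) = F a k c"
proof -
  have "map_terms F (pmonom a k c) = (\<Sum>a'\<in>{a}. \<Sum>k'\<in>{k}. F a' k' (pol_coeff (pmonom a k c) a' k'))"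
    by (intro map_terms_superset assms) (auto simp: pmonom_def lookup_single when_def split: if_splits)
  then show ?thesis by (simp add: pol_coeff_def pmonom_def)
qed

lemma pol_decomp: fixes h :: "('N::finite,'k) pol" shows "h = map_terms pmonom h"
proof -
  have "map_terms pmonom h = (\<Sum>a\<in>Poly_Mapping.keys h. Poly_Mapping.single a (Poly_Mapping.lookup h a))"
    unfolding map_terms_def
  proof (rule sum.cong[OF refl])
    fix a :: "(nat,'N) vec"
    have s: "Poly_Mapping.single a (\<Sum>k\<in>K. f k) = (\<Sum>k\<in>K. Poly_Mapping.single a (f k))" if "finite K" for K and f :: "'k \<Rightarrow> 'k \<Rightarrow>\<^sub>0 complex"
      using that by (induction K) (auto simp: single_add)
    show "(\<Sum>k\<in>Poly_Mapping.keys (Poly_Mapping.lookup h a). pmonom a k (pol_coeff h a k)) = Poly_Mapping.single a (Poly_Mapping.lookup h a)"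
      unfolding pmonom_def pol_coeff_def
      by (subst s[symmetric]) (simp_all add: poly_mapping_sum_monomials)
  qed
  then show ?thesis by (simp add: poly_mapping_sum_monomials)
qed

lemma additive_eqI:
  fixes f g :: "('N::finite,'k) pol \<Rightarrow> 'm::ab_group_add"
  assumes f: "\<And>p q. f (p + q) = f p + f q" and g: "\<And>p q. g (p + q) = g p + g q"
    and eq: "\<And>a k c. f (pmonom a k c) = g (pmonom a k c)"
  shows "f h = g h"
proof -
  have f0: "f 0 = 0" using f[of 0 0] by simp
  have g0: "g 0 = 0" using g[of 0 0] by simp
  have fs: "f (sum u A) = (\<Sum>x\<in>A. f (u x))" for u :: "(nat,'N) vec \<Rightarrow> _" and A
    by (induction A rule: infinite_finite_induct) (auto simp: f f0)
  have gs: "g (sum u A) = (\<Sum>x\<in>A. g (u x))" for u :: "(nat,'N) vec \<Rightarrow> _" and A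
    by (induction A rule: infinite_finite_induct) (auto simp: g g0)
  have fs2: "f (sum u A) = (\<Sum>x\<in>A. f (u x))" for u :: "'k \<Rightarrow> _" and A
    by (induction A rule: infinite_finite_induct) (auto simp: f f0)
  have gs2: "g (sum u A) = (\<Sum>x\<in>A. g (u x))" for u :: "'k \<Rightarrow> _" and A
    by (induction A rule: infinite_finite_induct) (auto simp: g g0)
  show ?thesis
    by (subst (1 2) pol_decomp) (simp add: map_terms_def fs gs fs2 gs2 eq)
qed

lemma partial_add: "partial_x j (p + q) = partial_x j p + partial_x j q"
  unfolding partial_x_def by (rule map_terms_add) (auto simp: pmonom_add algebra_simps)

lemma partial_monom: "partial_x j (pmonom a k c) = pmonom (a - axis j 1) k (of_nat (a $ j) * c)"
  unfolding partial_x_def by (rule map_terms_monom) auto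

lemma nat_minus_axis: "(a::(nat,'N::finite) vec) $ j \<noteq> 0 \<Longrightarrow> a - axis j 1 + b = a + b - axis j 1"
  "(a::(nat,'N::finite) vec) $ j \<noteq> 0 \<Longrightarrow> b + (a - axis j 1) = b + a - axis j 1"
  by (auto simp: vec_eq_iff axis_def)

lemma partial_mult: "partial_x j (p * q) = partial_x j p * q + p * partial_x j q"
proof -
  have "partial_x j (pmonom a k c * q) = partial_x j (pmonom a k c) * q + pmonom a k c * partial_x j q" for a c and k :: "'b" and q
  proof (rule additive_eqI[where h=q], goal_cases)
    case (3 a' k' c')
    have 1: "pmonom (a + a' - axis j 1) (k + k') (of_nat (a $ j) * (c * c')) = pmonom (a - axis j 1 + a') (k + k') (of_nat (a $ j) * (c * c'))"
      by (cases "a $ j = 0") (simp, simp only: nat_minus_axis not_False_eq_True)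
    have 2: "pmonom (a + a' - axis j 1) (k + k') (of_nat (a' $ j) * (c * c')) = pmonom (a + (a' - axis j 1)) (k + k') (of_nat (a' $ j) * (c * c'))"
      by (cases "a' $ j = 0") (simp, simp only: nat_minus_axis not_False_eq_True)
    have "partial_x j (pmonom a k c * pmonom a' k' c') = pmonom (a + a' - axis j 1) (k + k') (of_nat (a $ j) * (c * c')) + pmonom (a + a' - axis j 1) (k + k') (of_nat (a' $ j) * (c * c'))"
      by (simp only: pmonom_mult partial_monom pmonom_add[symmetric]) (simp add: algebra_simps)
    then show ?case
      by (simp only: 1 2 pmonom_mult partial_monom) (simp add: algebra_simps)
  qed (auto simp: partial_add algebra_simps)
  note monom_case = this
  show ?thesis
    by (rule additive_eqI[where h=p]) (auto simp: partial_add monom_case algebra_simps)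
qed

lemma partial_commute: "partial_x i (partial_x j p) = partial_x j (partial_x i p)"
proof (rule additive_eqI[where h=p], goal_cases)
  case (3 a k c)
  have 1: "a - axis j 1 - axis i 1 = a - axis i 1 - axis j 1" by (simp add: vec_eq_iff add.commute)
  show ?case
  proof (cases "i = j")
    case False
    then have "(a - axis j 1) $ i = a $ i" "(a - axis i 1) $ j = a $ j" by (simp_all add: axis_def)
    then show ?thesis unfolding partial_monom 1 by (simp only: ac_simps)
  qed simp
qed (auto simp: partial_add)

lemma nabla_add: "nabla y j (p + q) = nabla y j p + nabla y j q"
  by (simp add: nabla_def partial_add algebra_simps)

lemma nabla_mult: "nabla y j (p * q) = partial_x j p * q + p * nabla y j q"
  by (simp add: nabla_def partial_mult algebra_simps)

lemma partial_const: "partial_x j (pmonom 0 k c) = 0" by (simp add: partial_monom)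

lemma nabla_commute: "nabla y i (nabla y j p) = nabla y j (nabla y i p)"
  using partial_commute[of i j p] unfolding nabla_def partial_mult partial_add partial_const by (simp add: algebra_simps)

lemma foldr_commute:
  assumes "\<And>k h. f (F k h) = F k (f h)"
  shows "f (foldr F xs h) = foldr F xs (f h)"
  by (induction xs) (auto simp: assms)

lemma funpow_commute1: "(\<And>h. f (g h) = g (f h)) \<Longrightarrow> f ((g ^^ n) h) = (g ^^ n) (f h)"
  by (induction n) auto

lemma nabla_power_Suc: "nabla_power y (b + axis j 1) h = nabla y j (nabla_power y b h)"
proof -
  have "foldr (\<lambda>j. nabla y j ^^ ((b + axis i 1) $ j)) xs h
     = (if i \<in> set xs then nabla y i (foldr (\<lambda>j. nabla y j ^^ (b $ j)) xs h) else foldr (\<lambda>j. nabla y j ^^ (b $ j)) xs h)"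
    if "distinct xs" for xs i
    using that
  proof (induction xs)
    case (Cons x xs)
    have "nabla y i ((nabla y x ^^ n) h) = (nabla y x ^^ n) (nabla y i h)" for n h
      by (rule funpow_commute1) (rule nabla_commute)
    with Cons show ?case by (auto simp: axis_def Suc_eq_plus1[symmetric])
  qed simp
  then show ?thesis by (simp add: nabla_power_def)
qed

lemma nabla_power_0: "nabla_power y 0 h = h"
proof -
  have "foldr (\<lambda>j. nabla y j ^^ ((0::(nat,'a) vec) $ j)) xs h = h" for xs by (induction xs) auto
  then show ?thesis by (simp add: nabla_power_def)
qed

lemma nabla_power_add: "nabla_power y b (p + q) = nabla_power y b p + nabla_power y b q"
proof -
  have 1: "(nabla y j ^^ n) (p + q) = (nabla y j ^^ n) p + (nabla y j ^^ n) q" for j n p q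
    by (induction n) (auto simp: nabla_add)
  have "foldr (\<lambda>j. nabla y j ^^ (b $ j)) xs (p+q) = foldr (\<lambda>j. nabla y j ^^ (b $ j)) xs p + foldr (\<lambda>j. nabla y j ^^ (b $ j)) xs q" for xs
    by (induction xs) (auto simp: 1)
  then show ?thesis by (simp add: nabla_power_def)
qed

lemma act_add_left: "act y (P + Q) h = act y P h + act y Q h"
  unfolding act_def by (rule map_terms_add) (auto simp: pmonom_add algebra_simps)

lemma act_monom: "act y (pmonom a b c) h = pmonom a 0 c * nabla_power y b h"
  unfolding act_def by (rule map_terms_monom) auto

lemma act_add_right: "act y P (g + h) = act y P g + act y P h"
  by (rule additive_eqI[where h=P]) (auto simp: act_add_left act_monom nabla_power_add algebra_simps)

lemma act_one: "act y 1 h = h"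
  using act_monom[of y 0 0 1 h] by (simp add: pmonom_one nabla_power_0)

lemma act_nabla: "act y (nabla (\<lambda>j. axis j 1) j Q) h = nabla y j (act y Q h)"
proof (rule additive_eqI[where h=Q], goal_cases)
  case (3 a b c)
  have "nabla_power y (axis j 1 + b) h = nabla y j (nabla_power y b h)"
    using nabla_power_Suc[of y b j h] by (simp add: add.commute)
  then show ?case
    by (simp add: nabla_mult act_monom partial_monom act_add_left pmonom_mult nabla_def[of _ _ "pmonom _ _ _"])
qed (auto simp: act_add_left nabla_add)

lemma act_mult: "act y (pmonom a 0 c * Q) h = pmonom a 0 c * act y Q h"
  by (rule additive_eqI[where h=Q]) 
    (auto simp: act_add_left algebra_simps act_monom pmonom_mult mult.assoc[symmetric])

lemma act_weyl_mult: "act y (P \<star> Q) h = act y P (act y Q h)"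
  unfolding weyl_mult_def
proof (rule additive_eqI[where h=P], goal_cases)
  case (3 a b c)
  have "act y ((nabla (\<lambda>j. axis j 1) j ^^ n) Q) h = (nabla y j ^^ n) (act y Q h)" for j n Q
    by (induction n) (auto simp: act_nabla)
  then have "act y (foldr (\<lambda>j. nabla (\<lambda>j. axis j 1) j ^^ (b $ j)) xs Q) h = foldr (\<lambda>j. nabla y j ^^ (b $ j)) xs (act y Q h)" for xs
    by (induction xs) auto
  then show ?case by (simp add: act_monom act_mult nabla_power_def)
qed (auto simp: act_add_left)

lemma weyl_mult_one: "P \<star> 1 = P"
proof -
  have np: "nabla_power (\<lambda>j. axis j 1) b (pmonom 0 0 1) = pmonom 0 b 1" for b :: "(nat,'a) vec"
  proof -
    have 1: "(nabla (\<lambda>j. axis j 1) j ^^ n) (pmonom 0 b 1) = pmonom 0 (b + axis j n) 1" for j :: 'a and n and b :: "(nat,'a) vec"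
    proof (induction n)
      case (Suc n)
      have "axis j 1 + (b + axis j n) = b + axis j (Suc n)" by (auto simp: vec_eq_iff axis_def)
      then show ?case by (simp add: Suc) (simp add: nabla_def partial_monom pmonom_mult)
    next
      case 0
      have "b + axis j 0 = b" by (simp add: vec_eq_iff axis_def)
      then show ?case by (simp only: funpow_0)
    qed
    have "foldr (\<lambda>j. nabla (\<lambda>j. axis j 1) j ^^ (b $ j)) xs (pmonom 0 0 1) = pmonom 0 (\<Sum>j\<leftarrow>xs. axis j (b $ j)) 1" for xs
      by (induction xs) (auto simp: 1 add.commute)
    moreover have "(\<Sum>j\<leftarrow>sorted_list_of_set UNIV. axis j (b $ j)) = b"
      by (simp add: sum_list_distinct_conv_sum_set vec_eq_iff axis_def)
    ultimately show ?thesis by (simp add: nabla_power_def)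
  qed
  show ?thesis unfolding weyl_mult_def
    by (rule additive_eqI[where h=P]) (auto simp: act_add_left act_monom np[unfolded pmonom_one] pmonom_mult)
qed

lemma ring_weyl_algebra: "ring weyl_algebra"
proof (rule ringI)
  show "abelian_group weyl_algebra"
    by (rule abelian_groupI) (auto simp: weyl_algebra_def algebra_simps intro: exI[of _ "- x" for x])
  show "Group.monoid weyl_algebra"
    by (rule monoidI) (auto simp: weyl_algebra_def weyl_mult_one, (simp_all add: weyl_mult_def act_one act_weyl_mult[unfolded weyl_mult_def]))
qed (auto simp: weyl_algebra_def weyl_mult_def act_add_left act_add_right)

lemma weyl_relation: "d_op j \<star> x_op k = x_op k \<star> d_op j + (if j = k then 1 else 0)"
proof -
  have a: "nabla_power (\<lambda>j. axis j 1) (axis j 1) h = nabla (\<lambda>j. axis j 1) j h" for h :: "'a diff_op" and j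
    using nabla_power_Suc[of "\<lambda>j. axis j 1" 0 j h] by (simp add: nabla_power_0)
  show ?thesis
    apply (simp add: weyl_mult_def d_op_def x_op_def d_power_def act_monom a nabla_power_0 pmonom_one nabla_def partial_monom)
    by (auto simp: pmonom_mult axis_def pmonom_one)
qed

lemma pmonom_normal_form: "pmonom a b c = scalar_op c \<star> pmonom a 0 1 \<star> d_power b"
  by (simp add: weyl_mult_def scalar_op_def d_power_def act_monom act_mult nabla_power_0 pmonom_mult)

lemma act_generators: "d_op j \<star> P = nabla (\<lambda>j. axis j 1) j P"
   "act y (d_op j) h = nabla y j h" "act y (x_op j) h = pmonom (axis j 1) 0 1 * h"
  using nabla_power_Suc[of "\<lambda>j. axis j 1" 0 j P] nabla_power_Suc[of y 0 j h]
  by (simp_all add: weyl_mult_def d_op_def x_op_def d_power_def act_monom nabla_power_0 pmonom_one)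

declare One_nat_def [simp]


section \<open>Hypergeometric modules and their direct system\<close>

definition euler_op ::
  "int ^ 'N::{finite,linorder} ^ 'n::finite \<Rightarrow> complex ^ 'n \<Rightarrow> 'n \<Rightarrow> 'N diff_op"
  where "euler_op A \<beta> i =
    (\<Sum>j\<in>UNIV. scalar_op (of_int (A $ i $ j)) \<star> x_op j \<star> d_op j) + scalar_op (\<beta> $ i)"

definition box_op :: "(int, 'N::finite) vec \<Rightarrow> 'N diff_op"
  where "box_op l = d_power (\<chi> j. nat (l $ j)) - d_power (\<chi> j. nat (- l $ j))"

definition hyp_ideal ::
  "int ^ 'N::{finite,linorder} ^ 'n::finite \<Rightarrow> complex ^ 'n \<Rightarrow> 'N diff_op set"
  where "hyp_ideal A \<beta> = submodule_span weyl_algebra weyl_module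
    (range (euler_op A \<beta>) \<union> {box_op l | l. (\<Sum>j\<in>UNIV. l $ j *s column j A) = 0})"

definition hyp_module ::
  "int ^ 'N::{finite,linorder} ^ 'n::finite \<Rightarrow> complex ^ 'n \<Rightarrow> ('N diff_op, 'N diff_op set) module"
  where "hyp_module A \<beta> = quotient_module weyl_module (hyp_ideal A \<beta>)"

definition real_cone :: "int ^ 'N::finite ^ 'n::finite \<Rightarrow> (real ^ 'n) set"
  where "real_cone A = {\<Sum>j\<in>UNIV. c j *\<^sub>R (\<chi> i. real_of_int (A $ i $ j)) | c. \<forall>j. 0 \<le> c j}"

definition cone_lattice :: "int ^ 'N::finite ^ 'n::finite \<Rightarrow> (int ^ 'n) set"
  where "cone_lattice A = {v. (\<chi> i. real_of_int (v $ i)) \<in> real_cone A}"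

definition nat_comb :: "int ^ 'N::finite ^ 'n::finite \<Rightarrow> (nat, 'N) vec \<Rightarrow> int ^ 'n"
  where "nat_comb A a = (\<Sum>j\<in>UNIV. int (a $ j) *s column j A)"

definition cone_le :: "int ^ 'N::finite ^ 'n::finite \<Rightarrow> int ^ 'n \<Rightarrow> int ^ 'n \<Rightarrow> bool"
  where "cone_le A v1 v2 \<longleftrightarrow> (\<exists>a. v1 - v2 = nat_comb A a)"

definition shift :: "complex ^ 'n::finite \<Rightarrow> int ^ 'n \<Rightarrow> complex ^ 'n"
  where "shift \<gamma> v = \<gamma> + (\<chi> i. of_int (v $ i))"

text \<open>The induced map does not depend on the choice of \<open>a\<close>: for \<open>nat_comb A a = nat_comb A b\<close>
  the difference \<open>d_power a - d_power b\<close> is in the left ideal (an operator \<open>d_power\<close> times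
  \<open>box_op l\<close> with \<open>l = a - b\<close>).\<close>

definition hyp_transition ::
  "int ^ 'N::{finite,linorder} ^ 'n::finite \<Rightarrow> complex ^ 'n \<Rightarrow> int ^ 'n \<Rightarrow> int ^ 'n \<Rightarrow>
    'N diff_op set \<Rightarrow> 'N diff_op set"
  where "hyp_transition A \<gamma> v1 v2 =
    coset_map weyl_module (hyp_ideal A (shift \<gamma> v2))
      (\<lambda>P. P \<star> d_power (SOME a. v1 - v2 = nat_comb A a))"

definition hyp_colimit ::
  "int ^ 'N::{finite,linorder} ^ 'n::finite \<Rightarrow> complex ^ 'n \<Rightarrow>
    ('N diff_op, (int ^ 'n \<Rightarrow> 'N diff_op set) set) module"
  where "hyp_colimit A \<gamma> = colimit weyl_algebra (cone_lattice A) (cone_le A)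
    (\<lambda>v. hyp_module A (shift \<gamma> v)) (hyp_transition A \<gamma>)"


section \<open>The twisted de Rham complex\<close>

inductive_set cone_algebra ::
  "int ^ 'N::finite ^ 'n::finite \<Rightarrow> (int ^ 'n \<Rightarrow>\<^sub>0 complex) set"
  for A where
    const: "Poly_Mapping.single 0 c \<in> cone_algebra A"
  | monomial: "v \<in> cone_lattice A \<Longrightarrow> Poly_Mapping.single v 1 \<in> cone_algebra A"
  | add: "f \<in> cone_algebra A \<Longrightarrow> g \<in> cone_algebra A \<Longrightarrow> f + g \<in> cone_algebra A"
  | mult: "f \<in> cone_algebra A \<Longrightarrow> g \<in> cone_algebra A \<Longrightarrow> f * g \<in> cone_algebra A"

definition cone_functions :: "int ^ 'N::finite ^ 'n::finite \<Rightarrow> ('N, int ^ 'n) pol set"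
  where "cone_functions A = {h. \<forall>a. Poly_Mapping.lookup h a \<in> cone_algebra A}"

text \<open>\<open>t\<^sub>i \<partial>/\<partial>t\<^sub>i\<close>\<close>

definition t_partial_t :: "'n::finite \<Rightarrow> ('N::finite, int ^ 'n) pol \<Rightarrow> ('N, int ^ 'n) pol"
  where "t_partial_t i = map_terms (\<lambda>a v c. pmonom a v (of_int (v $ i) * c))"

definition twisted_t_partial_t ::
  "int ^ 'N::finite ^ 'n::finite \<Rightarrow> complex ^ 'n \<Rightarrow> 'n \<Rightarrow> ('N, int ^ 'n) pol \<Rightarrow> ('N, int ^ 'n) pol"
  where "twisted_t_partial_t A \<gamma> i h = t_partial_t i h + pmonom 0 0 (\<gamma> $ i) * h
    + (\<Sum>j\<in>UNIV. pmonom (axis j 1) (column j A) (of_int (A $ i $ j)) * h)"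

text \<open>A logarithmic form \<open>\<omega>\<close> is given by its coefficients: \<open>\<omega> I\<close> is the coefficient of
  \<open>dt\<^sub>i\<^sub>1/t\<^sub>i\<^sub>1 \<and> \<dots> \<and> dt\<^sub>i\<^sub>q/t\<^sub>i\<^sub>q\<close> for \<open>I = {i\<^sub>1 < \<dots> < i\<^sub>q}\<close>.\<close>

definition log_forms ::
  "int ^ 'N::{finite,linorder} ^ 'n::finite \<Rightarrow> nat \<Rightarrow>
    ('N diff_op, 'n set \<Rightarrow> ('N, int ^ 'n) pol) module"
  where "log_forms A q =
    \<lparr>carrier = {\<omega>. \<forall>I. \<omega> I \<in> cone_functions A \<and> (card I \<noteq> q \<longrightarrow> \<omega> I = 0)},
     mult = undefined, one = undefined,
     zero = (\<lambda>I. 0), add = (\<lambda>\<omega> \<eta> I. \<omega> I + \<eta> I),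
     smult = (\<lambda>P \<omega> I. act (\<lambda>j. column j A) P (\<omega> I))\<rparr>"

text \<open>For \<open>i \<in> J\<close>, moving \<open>dt\<^sub>i/t\<^sub>i\<close> from the front of the form indexed by \<open>J - {i}\<close> to its place
  in the form indexed by \<open>J\<close> passes the factors with index below \<open>i\<close>.\<close>

definition log_d ::
  "int ^ 'N::finite ^ 'n::{finite,linorder} \<Rightarrow> complex ^ 'n::{finite,linorder} \<Rightarrow>
    ('n set \<Rightarrow> ('N, int ^ 'n::{finite,linorder}) pol) \<Rightarrow> 'n set \<Rightarrow> ('N, int ^ 'n::{finite,linorder}) pol"
  where "log_d A \<gamma> \<omega> J =
    (\<Sum>i\<in>J. (- 1) ^ card {k \<in> J. k < i} * twisted_t_partial_t A \<gamma> i (\<omega> (J - {i})))"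

end

(*
  The isomorphism is induced by P |-> P . t^v on the v-th module of the system. Write D_i for the
  twisted derivation t_i d/dt_i + gamma_i + sum_j w_ij x_j t^(w_j), so that the top cohomology is the
  cokernel of D_1, ..., D_n. Since D_i commutes with the action of the Weyl algebra and the Euler
  operator with parameter gamma + v takes t^v to D_i(t^v), the map is well defined. Conversely send
  x^a t^v to the class of x^a in the v-th module. In the colimit the class of x_j x^a in the module
  at v + w_j is the class of x_j x^a d_j in the module at v, so D_i(x^a t^v) goes to the class of
  x^a times the Euler operator, which is zero.
*)
theory Submission
  imports Defs
begin

section \<open>Quotients, direct sums and induced homomorphisms\<close>

text \<open>The derivations D_i commute with the Weyl algebra because both are conjugates of plain
  derivations by the same formal function E = t^gamma exp(sum_j x_j t^(w_j)): D_i is t_i d/dt_i, and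
  the action of the j-th partial derivative is d/dx_j, each conjugated by E. The obstacle is that
  the index set need not be directed, so an element of the colimit need not come from a single
  module of the system. The colimit is therefore handled as a direct sum modulo relations, and one
  Laurent function h records all components at once: its coefficient of t^v, a polynomial in x, sits
  at index v. This fits because the exponents allowed in h are exactly the indices of the system.
  The assignment from functions back to the colimit is only used additively. Every f in the direct
  sum has a function h that represents it both in the cohomology and in the colimit, and an exact h
  has class zero in the colimit; this determines the kernel, while linearity over the Weyl algebra
  is carried by the forward map alone.\<close>

lemma module_homD:
  assumes "h \<in> module_hom R M L"
  shows "x \<in> carrier M \<Longrightarrow> h x \<in> carrier L"
    and "\<lbrakk>x \<in> carrier M; y \<in> carrier M\<rbrakk> \<Longrightarrow> h (x \<oplus>\<^bsub>M\<^esub> y) = h x \<oplus>\<^bsub>L\<^esub> h y"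
    and "\<lbrakk>r \<in> carrier R; x \<in> carrier M\<rbrakk> \<Longrightarrow> h (r \<odot>\<^bsub>M\<^esub> x) = r \<odot>\<^bsub>L\<^esub> h x"
  using assms by (auto simp: module_hom_def)

lemma abelian_group_hom_if_additive:
  assumes "abelian_group G" "abelian_group H" "h \<in> carrier G \<rightarrow> carrier H"
    "\<And>x y. \<lbrakk>x \<in> carrier G; y \<in> carrier G\<rbrakk> \<Longrightarrow> h (x \<oplus>\<^bsub>G\<^esub> y) = h x \<oplus>\<^bsub>H\<^esub> h y"
  shows "abelian_group_hom G H h"
proof (rule abelian_group_homI)
  show "group_hom (add_monoid G) (add_monoid H) h"
    using assms by (intro group_hom.intro group_hom_axioms.intro abelian_group.a_group)
      (auto simp: hom_def)
qed (use assms in auto)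

lemma (in left_module) smult_add_hom:
  assumes "r \<in> carrier R"
  shows "abelian_group_hom M M (\<lambda>x. r \<odot>\<^bsub>M\<^esub> x)"
  using assms M.abelian_group_axioms
  by (intro abelian_group_hom_if_additive) (auto simp: smult_closed smult_r_distr)

lemma (in left_module) smult_zero:
  "r \<in> carrier R \<Longrightarrow> r \<odot>\<^bsub>M\<^esub> \<zero>\<^bsub>M\<^esub> = \<zero>\<^bsub>M\<^esub>"
  using abelian_group_hom.hom_zero[OF smult_add_hom] .

text \<open>Lets negatives be obtained as scalar multiples, so that closure under scalars yields
  both closure of submodules under negation and inverses in direct sums.\<close>

lemma (in left_module) smult_minus_one:
  assumes x: "x \<in> carrier M"
  shows "(\<ominus> \<one>) \<odot>\<^bsub>M\<^esub> x = \<ominus>\<^bsub>M\<^esub> x"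
proof -
  have "\<zero> \<odot>\<^bsub>M\<^esub> x \<oplus>\<^bsub>M\<^esub> \<zero> \<odot>\<^bsub>M\<^esub> x = \<zero> \<odot>\<^bsub>M\<^esub> x"
    using smult_l_distr[of \<zero> \<zero> x] x by simp
  then have "\<zero> \<odot>\<^bsub>M\<^esub> x = \<zero>\<^bsub>M\<^esub>"
    using x by (simp add: smult_closed M.add.l_cancel_one)
  then have "(\<ominus> \<one>) \<odot>\<^bsub>M\<^esub> x \<oplus>\<^bsub>M\<^esub> x = \<zero>\<^bsub>M\<^esub>"
    using smult_l_distr[of "\<ominus> \<one>" \<one> x] x by (simp add: smult_one R.l_neg)
  then show ?thesis
    using x by (intro M.minus_equality[symmetric]) (auto simp: smult_closed)
qed

lemma (in left_module) submoduleI: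
  assumes "H \<subseteq> carrier M" "\<zero>\<^bsub>M\<^esub> \<in> H"
    and "\<And>x y. \<lbrakk>x \<in> H; y \<in> H\<rbrakk> \<Longrightarrow> x \<oplus>\<^bsub>M\<^esub> y \<in> H"
    and smult: "\<And>r x. \<lbrakk>r \<in> carrier R; x \<in> H\<rbrakk> \<Longrightarrow> r \<odot>\<^bsub>M\<^esub> x \<in> H"
  shows "submodule H R M"
proof -
  have "\<ominus>\<^bsub>M\<^esub> x \<in> H" if "x \<in> H" for x
    using smult[of "\<ominus> \<one>" x] smult_minus_one[of x] assms(1) that by auto
  with assms show ?thesis
    by (intro submodule.intro subgroup.intro submodule_axioms.intro) (auto simp: a_inv_def)
qed

lemma submoduleD:
  assumes "submodule H R M"
  shows "x \<in> H \<Longrightarrow> x \<in> carrier M" and "\<zero>\<^bsub>M\<^esub> \<in> H"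
    and "\<lbrakk>x \<in> H; y \<in> H\<rbrakk> \<Longrightarrow> x \<oplus>\<^bsub>M\<^esub> y \<in> H"
    and "x \<in> H \<Longrightarrow> \<ominus>\<^bsub>M\<^esub> x \<in> H"
    and "\<lbrakk>r \<in> carrier R; x \<in> H\<rbrakk> \<Longrightarrow> r \<odot>\<^bsub>M\<^esub> x \<in> H"
  using submodule.axioms(1)[OF assms] submodule.smult_closed[OF assms]
  by (auto dest: subgroup.mem_carrier subgroup.one_closed subgroup.m_closed subgroup.m_inv_closed
      simp: a_inv_def)

lemma submodule_span_incl: "S \<subseteq> submodule_span R M S"
  by (auto simp: submodule_span_def)

lemma submodule_span_minimal:
  "\<lbrakk>submodule K R M; S \<subseteq> K\<rbrakk> \<Longrightarrow> submodule_span R M S \<subseteq> K"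
  by (auto simp: submodule_span_def)

text \<open>Shows that the intersection defining \<open>submodule_span\<close> runs over a nonempty
  family, so that the span of elements of the carrier stays in the carrier.\<close>

lemma (in left_module) carrier_submodule: "submodule (carrier M) R M"
  by (rule submoduleI) (auto simp: smult_closed)

lemma (in left_module) submodule_kernel:
  assumes "left_module R L" "h \<in> module_hom R M L"
  shows "submodule {x \<in> carrier M. h x = \<zero>\<^bsub>L\<^esub>} R M"
proof -
  interpret L: left_module R L by fact
  interpret h: abelian_group_hom M L h
    using assms(2) M.abelian_group_axioms L.M.abelian_group_axioms
    by (intro abelian_group_hom_if_additive) (auto simp: module_hom_def)
  show ?thesis
    by (rule submoduleI) (auto simp: module_homD[OF assms(2)] smult_closed L.smult_zero)
qed

lemma (in left_module) abelian_subgroup_submodule: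
  "submodule K R M \<Longrightarrow> abelian_subgroup K M"
  by (intro abelian_subgroupI3 additive_subgroupI submodule.axioms(1) M.abelian_group_axioms)

section \<open>Quotient modules and maps out of them\<close>

lemma carrier_quotient_module:
  "carrier (quotient_module M K) = (\<lambda>x. K +>\<^bsub>M\<^esub> x) ` carrier M"
  by (auto simp: quotient_module_def A_RCOSETS_def')

lemma zero_quotient_module [simp]: "\<zero>\<^bsub>quotient_module M K\<^esub> = K"
  by (simp add: quotient_module_def)

lemma (in abelian_subgroup) coset_eq_iff:
  assumes "x \<in> carrier G" "y \<in> carrier G"
  shows "H +> x = H +> y \<longleftrightarrow> x \<ominus> y \<in> H"
proof
  assume "H +> x = H +> y"
  then show "x \<ominus> y \<in> H"
    using a_rcos_self[OF assms(1)] a_rcos_module[OF assms(2,1)] by (simp add: minus_eq)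
next
  assume "x \<ominus> y \<in> H"
  then have "x \<in> H +> y"
    using a_rcos_module[OF assms(2,1)] by (simp add: minus_eq)
  then show "H +> x = H +> y"
    using a_repr_independence'[OF _ assms(2)] by simp
qed

text \<open>The union in \<open>coset_map\<close> collapses: two representatives differ by an
  element of \<open>H\<close>, which \<open>f\<close> sends into \<open>K\<close>, so all cosets in
  the union agree, and the index set contains \<open>x\<close>.\<close>

lemma coset_map_coset:
  assumes "abelian_subgroup H G" "abelian_subgroup K L" "abelian_group_hom G L f" "f ` H \<subseteq> K"
    and x: "x \<in> carrier G"
  shows "coset_map L K f (H +>\<^bsub>G\<^esub> x) = K +>\<^bsub>L\<^esub> f x"
proof -
  interpret H: abelian_subgroup H G by fact
  interpret K: abelian_subgroup K L by fact
  interpret f: abelian_group_hom G L f by fact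
  have "K +>\<^bsub>L\<^esub> f y = K +>\<^bsub>L\<^esub> f x" if y: "y \<in> H +>\<^bsub>G\<^esub> x" for y
  proof -
    from y obtain h where "h \<in> H" "y = h \<oplus>\<^bsub>G\<^esub> x" by (auto simp: a_r_coset_def')
    then have "f y = f h \<oplus>\<^bsub>L\<^esub> f x" "f h \<in> K" using x assms(4) by auto
    then show ?thesis
      using x by (intro K.a_repr_independence'[symmetric]) (auto simp: a_r_coset_def')
  qed
  then have "coset_map L K f (H +>\<^bsub>G\<^esub> x) = (\<Union>y\<in>H +>\<^bsub>G\<^esub> x. K +>\<^bsub>L\<^esub> f x)"
    unfolding coset_map_def by (intro SUP_cong refl)
  then show ?thesis
    using H.a_rcos_self[OF x] by auto
qed

text \<open>Here the target is a module rather than a quotient, so the common value of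
  \<open>h\<close> on a coset is extracted instead of a union being taken. The value is meaningful
  only if \<open>h\<close> is constant on \<open>X\<close>.\<close>

definition induced_map :: "('a \<Rightarrow> 'b) \<Rightarrow> 'a set \<Rightarrow> 'b"
  where "induced_map h X = the_elem (h ` X)"

context
  fixes R :: "('r, 'e) ring_scheme" (structure) and M :: "('r, 'a) module" (structure)
  assumes left_module: "left_module R M"
begin

interpretation left_module R M by (rule left_module)

lemma submodule_span:
  assumes "S \<subseteq> carrier M"
  shows "submodule (submodule_span R M S) R M"
  using carrier_submodule assms
  by (intro submoduleI) (auto simp: submodule_span_def intro: submoduleD)

lemma
  assumes K: "submodule K R M"
  shows add_coset: "\<lbrakk>x \<in> carrier M; y \<in> carrier M\<rbrakk> \<Longrightarrow>
      (K +>\<^bsub>M\<^esub> x) \<oplus>\<^bsub>quotient_module M K\<^esub> (K +>\<^bsub>M\<^esub> y) = K +>\<^bsub>M\<^esub> (x \<oplus>\<^bsub>M\<^esub> y)"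
    and smult_coset: "\<lbrakk>r \<in> carrier R; x \<in> carrier M\<rbrakk> \<Longrightarrow>
      r \<odot>\<^bsub>quotient_module M K\<^esub> (K +>\<^bsub>M\<^esub> x) = K +>\<^bsub>M\<^esub> (r \<odot>\<^bsub>M\<^esub> x)"
proof -
  interpret K: abelian_subgroup K M by (rule abelian_subgroup_submodule[OF K])
  show "\<lbrakk>x \<in> carrier M; y \<in> carrier M\<rbrakk> \<Longrightarrow>
      (K +>\<^bsub>M\<^esub> x) \<oplus>\<^bsub>quotient_module M K\<^esub> (K +>\<^bsub>M\<^esub> y) = K +>\<^bsub>M\<^esub> (x \<oplus>\<^bsub>M\<^esub> y)"
    by (simp add: quotient_module_def K.a_rcos_sum)
  assume "r \<in> carrier R" "x \<in> carrier M"
  then show "r \<odot>\<^bsub>quotient_module M K\<^esub> (K +>\<^bsub>M\<^esub> x) = K +>\<^bsub>M\<^esub> (r \<odot>\<^bsub>M\<^esub> x)"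
    using coset_map_coset[OF K.abelian_subgroup_axioms K.abelian_subgroup_axioms smult_add_hom, of r x]
    by (simp add: quotient_module_def submoduleD[OF K] image_subset_iff)
qed

lemma left_module_quotient:
  assumes K: "submodule K R M"
  shows "left_module R (quotient_module M K)"
proof -
  interpret K: abelian_subgroup K M by (rule abelian_subgroup_submodule[OF K])
  have zero: "K +>\<^bsub>M\<^esub> \<zero>\<^bsub>M\<^esub> = K"
    by (rule M.a_coset_add_zero[OF K.a_subset])
  have "abelian_group (quotient_module M K)"
  proof (rule abelian_groupI, goal_cases)
    case (6 X)
    then obtain x where "x \<in> carrier M" "X = K +>\<^bsub>M\<^esub> x"
      by (auto simp: carrier_quotient_module)
    then show ?case
      using zero by (intro bexI[of _ "K +>\<^bsub>M\<^esub> (\<ominus>\<^bsub>M\<^esub> x)"])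
        (auto simp: carrier_quotient_module add_coset[OF K] M.l_neg)
  next
    case (5 X)
    then obtain x where "x \<in> carrier M" "X = K +>\<^bsub>M\<^esub> x"
      by (auto simp: carrier_quotient_module)
    then show ?case
      using add_coset[OF K, of "\<zero>\<^bsub>M\<^esub>" x] zero by simp
  next
    case 2
    show ?case using zero by (force simp: carrier_quotient_module)
  next
    case (3 X Y Z)
    then show ?case by (auto simp: carrier_quotient_module add_coset[OF K] M.a_assoc)
  next
    case (4 X Y)
    then show ?case by (auto simp: carrier_quotient_module add_coset[OF K] M.a_comm)
  qed (auto simp: carrier_quotient_module add_coset[OF K])
  then show ?thesis
    by (intro left_module.intro left_module_axioms.intro R.ring_axioms)
      (auto simp: carrier_quotient_module add_coset[OF K] smult_coset[OF K] smult_closed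
        smult_l_distr smult_r_distr smult_assoc smult_one)
qed

lemma
  assumes L: "left_module R L" and h: "h \<in> module_hom R M L"
    and K: "submodule K R M" and hK: "\<And>x. x \<in> K \<Longrightarrow> h x = \<zero>\<^bsub>L\<^esub>"
  shows induced_map_coset: "x \<in> carrier M \<Longrightarrow> induced_map h (K +>\<^bsub>M\<^esub> x) = h x"
    and induced_map_hom: "induced_map h \<in> module_hom R (quotient_module M K) L"
proof -
  interpret L: left_module R L by fact
  interpret K: abelian_subgroup K M by (rule abelian_subgroup_submodule[OF K])
  have eq: "induced_map h (K +>\<^bsub>M\<^esub> x) = h x" if x: "x \<in> carrier M" for x
  proof -
    have "h ` (K +>\<^bsub>M\<^esub> x) = {h x}"
      using x K.a_rcos_self[OF x] by (auto simp: a_r_coset_def' module_homD[OF h] hK submoduleD[OF K])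
    then show ?thesis by (simp add: induced_map_def)
  qed
  then show "x \<in> carrier M \<Longrightarrow> induced_map h (K +>\<^bsub>M\<^esub> x) = h x" .
  show "induced_map h \<in> module_hom R (quotient_module M K) L"
    by (auto simp: module_hom_def carrier_quotient_module add_coset[OF K] smult_coset[OF K] eq
        module_homD[OF h] smult_closed)
qed

text \<open>The first isomorphism theorem, in the form that reduces the final result to surjectivity
  and the computation of a kernel.\<close>

lemma quotient_isomorphic:
  assumes L: "left_module R L" and h: "h \<in> module_hom R M L" "h ` carrier M = carrier L"
    and K: "submodule K R M" and kernel: "\<And>x. x \<in> carrier M \<Longrightarrow> h x = \<zero>\<^bsub>L\<^esub> \<longleftrightarrow> x \<in> K"
  shows "module_isomorphic R (quotient_module M K) L"
proof -
  interpret L: left_module R L by fact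
  interpret K: abelian_subgroup K M by (rule abelian_subgroup_submodule[OF K])
  interpret h: abelian_group_hom M L h
    using h(1) M.abelian_group_axioms L.M.abelian_group_axioms
    by (intro abelian_group_hom_if_additive) (auto simp: module_hom_def)
  have hK: "h x = \<zero>\<^bsub>L\<^esub>" if "x \<in> K" for x
    using that kernel submoduleD(1)[OF K] by blast
  note coset = induced_map_coset[OF L h(1) K hK]
  have "inj_on (induced_map h) (carrier (quotient_module M K))"
  proof (rule inj_onI)
    fix X Y
    assume "X \<in> carrier (quotient_module M K)" "Y \<in> carrier (quotient_module M K)"
      and eq: "induced_map h X = induced_map h Y"
    then obtain x y where x: "x \<in> carrier M" "X = K +>\<^bsub>M\<^esub> x"
      and y: "y \<in> carrier M" "Y = K +>\<^bsub>M\<^esub> y"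
      by (auto simp: carrier_quotient_module)
    then have "h (x \<ominus>\<^bsub>M\<^esub> y) = \<zero>\<^bsub>L\<^esub>"
      using eq by (simp add: coset M.minus_eq L.M.r_neg)
    then show "X = Y"
      using x y kernel[of "x \<ominus>\<^bsub>M\<^esub> y"] by (simp add: K.coset_eq_iff)
  qed
  moreover have "induced_map h ` carrier (quotient_module M K) = carrier L"
    unfolding carrier_quotient_module image_image h(2)[symmetric]
    by (rule image_cong) (simp_all add: coset)
  ultimately show ?thesis
    using L left_module_quotient[OF K] induced_map_hom[OF L h(1) K hK]
    by (auto simp: module_isomorphic_def bij_betw_def)
qed

end

lemma (in left_module) submodule_image:
  assumes "left_module R L" "h \<in> module_hom R L M"
  shows "submodule (h ` carrier L) R M"
proof -
  interpret L: left_module R L by fact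
  interpret h: abelian_group_hom L M h
    using assms(2) M.abelian_group_axioms L.M.abelian_group_axioms
    by (intro abelian_group_hom_if_additive) (auto simp: module_hom_def)
  show ?thesis
  proof (rule submoduleI, goal_cases)
    case 2
    show ?case by (metis L.M.zero_closed h.hom_zero imageI)
  next
    case (3 x y)
    then obtain u v where "u \<in> carrier L" "v \<in> carrier L" "x = h u" "y = h v" by auto
    then show ?case by (intro image_eqI[of _ _ "u \<oplus>\<^bsub>L\<^esub> v"]) auto
  next
    case (4 r x)
    then obtain u where "u \<in> carrier L" "x = h u" by auto
    then show ?case
      using 4 by (intro image_eqI[of _ _ "r \<odot>\<^bsub>L\<^esub> u"]) (auto simp: module_homD[OF assms(2)] L.smult_closed)
  qed auto
qed

section \<open>Direct sums and their universal property\<close>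

lemma carrier_direct_sum:
  "f \<in> carrier (direct_sum I M) \<longleftrightarrow>
    f \<in> (\<Pi>\<^sub>E i\<in>I. carrier (M i)) \<and> finite {i \<in> I. f i \<noteq> \<zero>\<^bsub>M i\<^esub>}"
  by (simp add: direct_sum_def)

lemma direct_sum_simps:
  "\<zero>\<^bsub>direct_sum I M\<^esub> = (\<lambda>i\<in>I. \<zero>\<^bsub>M i\<^esub>)"
  "f \<oplus>\<^bsub>direct_sum I M\<^esub> g = (\<lambda>i\<in>I. f i \<oplus>\<^bsub>M i\<^esub> g i)"
  "r \<odot>\<^bsub>direct_sum I M\<^esub> f = (\<lambda>i\<in>I. r \<odot>\<^bsub>M i\<^esub> f i)"
  by (simp_all add: direct_sum_def)

text \<open>The map supplied by the universal property; summing over the support keeps the sum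
  finite for an infinite \<open>I\<close>.\<close>

definition direct_sum_lift ::
  "'i set \<Rightarrow> ('i \<Rightarrow> ('r, 'a) module) \<Rightarrow> ('r, 'b) module \<Rightarrow> ('i \<Rightarrow> 'a \<Rightarrow> 'b) \<Rightarrow> ('i \<Rightarrow> 'a) \<Rightarrow> 'b"
  where "direct_sum_lift I M L g f = (\<Oplus>\<^bsub>L\<^esub>i\<in>{i \<in> I. f i \<noteq> \<zero>\<^bsub>M i\<^esub>}. g i (f i))"

locale module_family =
  fixes R :: "('r, 'e) ring_scheme" and I :: "'i set" and M :: "'i \<Rightarrow> ('r, 'a) module"
  assumes ring: "ring R" and left_modules: "i \<in> I \<Longrightarrow> left_module R (M i)"
begin

lemmas abelian_groups = left_module.axioms(2)[OF left_modules]
lemmas abelian_monoids = abelian_groups[THEN abelian_group.axioms(1)]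

lemma component_closed:
  "\<lbrakk>f \<in> carrier (direct_sum I M); i \<in> I\<rbrakk> \<Longrightarrow> f i \<in> carrier (M i)"
  by (auto simp: carrier_direct_sum)

lemma support_add:
  assumes "f \<in> carrier (direct_sum I M)" "g \<in> carrier (direct_sum I M)"
  shows "{i \<in> I. f i \<oplus>\<^bsub>M i\<^esub> g i \<noteq> \<zero>\<^bsub>M i\<^esub>} \<subseteq>
    {i \<in> I. f i \<noteq> \<zero>\<^bsub>M i\<^esub>} \<union> {i \<in> I. g i \<noteq> \<zero>\<^bsub>M i\<^esub>}"
  by (auto simp: abelian_monoids[THEN abelian_monoid.l_zero]
      abelian_monoids[THEN abelian_monoid.zero_closed])

lemma add_closed:
  assumes "f \<in> carrier (direct_sum I M)" "g \<in> carrier (direct_sum I M)"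
  shows "f \<oplus>\<^bsub>direct_sum I M\<^esub> g \<in> carrier (direct_sum I M)"
proof -
  have "finite {i \<in> I. f i \<oplus>\<^bsub>M i\<^esub> g i \<noteq> \<zero>\<^bsub>M i\<^esub>}"
    using finite_subset[OF support_add[OF assms]] assms by (simp add: carrier_direct_sum)
  moreover have "f i \<oplus>\<^bsub>M i\<^esub> g i \<in> carrier (M i)" if "i \<in> I" for i
    using that assms by (simp add: component_closed abelian_monoids[THEN abelian_monoid.a_closed])
  ultimately show ?thesis
    by (simp add: carrier_direct_sum direct_sum_simps cong: conj_cong)
qed

lemma smult_closed:
  assumes "r \<in> carrier R" "f \<in> carrier (direct_sum I M)"
  shows "r \<odot>\<^bsub>direct_sum I M\<^esub> f \<in> carrier (direct_sum I M)"
proof -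
  have "{i \<in> I. r \<odot>\<^bsub>M i\<^esub> f i \<noteq> \<zero>\<^bsub>M i\<^esub>} \<subseteq> {i \<in> I. f i \<noteq> \<zero>\<^bsub>M i\<^esub>}"
    using assms(1) by (auto simp: left_modules[THEN left_module.smult_zero])
  then have "finite {i \<in> I. r \<odot>\<^bsub>M i\<^esub> f i \<noteq> \<zero>\<^bsub>M i\<^esub>}"
    using finite_subset assms by (auto simp: carrier_direct_sum)
  moreover have "r \<odot>\<^bsub>M i\<^esub> f i \<in> carrier (M i)" if "i \<in> I" for i
    using that assms by (simp add: component_closed left_modules[THEN left_module.smult_closed])
  ultimately show ?thesis
    by (simp add: carrier_direct_sum direct_sum_simps cong: conj_cong)
qed

lemma direct_sum_extensional:
  "f \<in> carrier (direct_sum I M) \<Longrightarrow> (\<lambda>i\<in>I. f i) = f"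
  by (auto simp: carrier_direct_sum)

lemma zero_in_direct_sum: "(\<lambda>i\<in>I. \<zero>\<^bsub>M i\<^esub>) \<in> carrier (direct_sum I M)"
  by (auto simp: carrier_direct_sum abelian_monoids[THEN abelian_monoid.zero_closed] cong: conj_cong)

lemma left_module_direct_sum: "left_module R (direct_sum I M)"
proof -
  interpret R: ring R by (rule ring)
  have "abelian_group (direct_sum I M)"
  proof (rule abelian_groupI, goal_cases)
    case (3 f g h)
    then show ?case
      by (auto simp: direct_sum_simps fun_eq_iff restrict_def component_closed abelian_monoids[THEN abelian_monoid.a_assoc])
  next
    case (4 f g)
    then show ?case
      by (auto simp: direct_sum_simps fun_eq_iff restrict_def component_closed abelian_monoids[THEN abelian_monoid.a_comm])
  next
    case (5 f)
    have "(\<lambda>i\<in>I. \<zero>\<^bsub>M i\<^esub> \<oplus>\<^bsub>M i\<^esub> f i) = (\<lambda>i\<in>I. f i)"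
      using 5 by (intro restrict_ext) (simp add: component_closed abelian_monoids[THEN abelian_monoid.l_zero])
    then show ?case
      by (simp add: direct_sum_simps direct_sum_extensional[OF 5] cong: restrict_cong)
  next
    \<comment> \<open>The inverse of \<open>f\<close> is taken to be -1 times \<open>f\<close>,
      whose finite support is already part of \<open>smult_closed\<close>.\<close>
    case (6 f)
    have "(\<ominus>\<^bsub>R\<^esub> \<one>\<^bsub>R\<^esub>) \<odot>\<^bsub>M i\<^esub> f i \<oplus>\<^bsub>M i\<^esub> f i = \<zero>\<^bsub>M i\<^esub>" if "i \<in> I" for i
      using that abelian_group.l_neg[OF abelian_groups component_closed[OF 6 that]]
      by (simp add: left_module.smult_minus_one[OF left_modules] component_closed[OF 6 that])
    then show ?case
      using smult_closed[OF _ 6, of "\<ominus>\<^bsub>R\<^esub> \<one>\<^bsub>R\<^esub>"]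
      by (intro bexI[of _ "(\<ominus>\<^bsub>R\<^esub> \<one>\<^bsub>R\<^esub>) \<odot>\<^bsub>direct_sum I M\<^esub> f"])
        (auto simp: direct_sum_simps cong: restrict_cong)
  qed (auto simp: add_closed zero_in_direct_sum direct_sum_simps(1))
  then show ?thesis
    using ring smult_closed
  proof (intro left_module.intro left_module_axioms.intro, goal_cases)
    case (4 a b f)
    then show ?case
      by (auto simp: direct_sum_simps component_closed left_modules[THEN left_module.smult_l_distr]
          intro!: restrict_ext)
  next
    case (5 a f g)
    then show ?case
      by (auto simp: direct_sum_simps component_closed left_modules[THEN left_module.smult_r_distr]
          intro!: restrict_ext)
  next
    case (6 a b f)
    then show ?case
      by (auto simp: direct_sum_simps component_closed left_modules[THEN left_module.smult_assoc]
          intro!: restrict_ext)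
  next
    case (7 f)
    have "(\<lambda>i\<in>I. \<one>\<^bsub>R\<^esub> \<odot>\<^bsub>M i\<^esub> f i) = (\<lambda>i\<in>I. f i)"
      using 7 by (intro restrict_ext)
        (simp add: component_closed left_modules[THEN left_module.smult_one])
    then show ?case
      by (simp add: direct_sum_simps direct_sum_extensional[OF 7(4)])
  qed auto
qed

lemma inj_hom:
  assumes "i \<in> I"
  shows "direct_sum_inj I M i \<in> module_hom R (M i) (direct_sum I M)"
proof -
  have "finite {k \<in> I. (if k = i then x else \<zero>\<^bsub>M k\<^esub>) \<noteq> \<zero>\<^bsub>M k\<^esub>}" for x
    by (rule finite_subset[of _ "{i}"]) auto
  then show ?thesis
    using assms
    by (auto simp: module_hom_def carrier_direct_sum direct_sum_inj_def direct_sum_simps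
        fun_eq_iff restrict_def left_modules[THEN left_module.smult_zero]
        abelian_monoids[THEN abelian_monoid.zero_closed]
        abelian_monoids[THEN abelian_monoid.l_zero] cong: conj_cong)
qed

text \<open>Elements concentrated at one index generate the direct sum additively, by induction on
  the finite support; additive statements need checking only on them.\<close>

lemma direct_sum_induct [consumes 1, case_names zero inj add]:
  assumes "f \<in> carrier (direct_sum I M)"
    and zero: "P \<zero>\<^bsub>direct_sum I M\<^esub>"
    and inj: "\<And>i x. \<lbrakk>i \<in> I; x \<in> carrier (M i)\<rbrakk> \<Longrightarrow> P (direct_sum_inj I M i x)"
    and add: "\<And>f g. \<lbrakk>f \<in> carrier (direct_sum I M); g \<in> carrier (direct_sum I M); P f; P g\<rbrakk> \<Longrightarrow>
      P (f \<oplus>\<^bsub>direct_sum I M\<^esub> g)"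
  shows "P f"
proof -
  have "\<lbrakk>f \<in> carrier (direct_sum I M); {i \<in> I. f i \<noteq> \<zero>\<^bsub>M i\<^esub>} = S\<rbrakk> \<Longrightarrow> P f" if "finite S" for S f
    using that
  proof (induction S arbitrary: f)
    case empty
    then have "(\<lambda>i\<in>I. f i) = (\<lambda>i\<in>I. \<zero>\<^bsub>M i\<^esub>)"
      by (intro restrict_ext) auto
    then show ?case
      using zero by (simp only: direct_sum_extensional[OF empty.prems(1)] direct_sum_simps(1))
  next
    case (insert k S)
    \<comment> \<open>\<open>f\<close> with its component at \<open>k\<close> erased; its support is
      the smaller set \<open>S\<close>.\<close>
    let ?g = "\<lambda>i\<in>I. if i = k then \<zero>\<^bsub>M i\<^esub> else f i"
    have k: "k \<in> I" and S: "{i \<in> I. ?g i \<noteq> \<zero>\<^bsub>M i\<^esub>} = S"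
      using insert.prems(2) insert.hyps(2) by (auto split: if_splits)
      have g: "?g \<in> carrier (direct_sum I M)"
      using S insert.hyps(1) insert.prems(1)
      by (auto simp: carrier_direct_sum abelian_monoids[THEN abelian_monoid.zero_closed])
    have fk: "f k \<in> carrier (M k)"
      using insert.prems(1) k by (rule component_closed)
    have "direct_sum_inj I M k (f k) \<oplus>\<^bsub>direct_sum I M\<^esub> ?g = (\<lambda>i\<in>I. f i)"
      using insert.prems(1)
      by (auto simp: direct_sum_inj_def direct_sum_simps component_closed
          abelian_monoids[THEN abelian_monoid.l_zero]
          abelian_monoids[THEN abelian_monoid.r_zero] intro!: restrict_ext)
    moreover have "P (direct_sum_inj I M k (f k) \<oplus>\<^bsub>direct_sum I M\<^esub> ?g)"
      by (intro add inj k fk insert.IH g S module_homD[OF inj_hom])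
    ultimately show ?case
      using insert.prems(1) by (simp add: direct_sum_extensional)
  qed
  then show ?thesis
    using assms(1) by (auto simp: carrier_direct_sum)
qed

context
  fixes L :: "('r, 'b) module" and g :: "'i \<Rightarrow> 'a \<Rightarrow> 'b"
  assumes L: "left_module R L" and g: "\<And>i. i \<in> I \<Longrightarrow> g i \<in> module_hom R (M i) L"
begin

interpretation L: left_module R L by (rule L)

lemma lift_component_zero: "i \<in> I \<Longrightarrow> g i \<zero>\<^bsub>M i\<^esub> = \<zero>\<^bsub>L\<^esub>"
  using abelian_group_hom.hom_zero[of "M i" L "g i"]
    abelian_group_hom_if_additive[OF abelian_groups L.M.abelian_group_axioms, of i "g i"] g
  by (auto simp: module_hom_def)

text \<open>The supports of two summands and of their sum differ, so additivity has to be compared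
  over a common finite set.\<close>

lemma direct_sum_lift_superset:
  assumes f: "f \<in> carrier (direct_sum I M)"
    and S: "finite S" "S \<subseteq> I" "{i \<in> I. f i \<noteq> \<zero>\<^bsub>M i\<^esub>} \<subseteq> S"
  shows "direct_sum_lift I M L g f = (\<Oplus>\<^bsub>L\<^esub>i\<in>S. g i (f i))"
  unfolding direct_sum_lift_def
  by (rule L.M.add.finprod_mono_neutral_cong_left)
    (use assms in \<open>auto simp: lift_component_zero module_homD(1)[OF g] component_closed\<close>)

lemma direct_sum_lift_inj:
  assumes i: "i \<in> I" and x: "x \<in> carrier (M i)"
  shows "direct_sum_lift I M L g (direct_sum_inj I M i x) = g i x"
proof -
  have "direct_sum_lift I M L g (direct_sum_inj I M i x) =
      (\<Oplus>\<^bsub>L\<^esub>k\<in>{i}. g k (direct_sum_inj I M i x k))"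
    using assms by (intro direct_sum_lift_superset module_homD(1)[OF inj_hom])
      (auto simp: direct_sum_inj_def)
  then show ?thesis
    using assms by (simp add: direct_sum_inj_def module_homD(1)[OF g])
qed

lemma direct_sum_lift_hom: "direct_sum_lift I M L g \<in> module_hom R (direct_sum I M) L"
proof -
  have closed: "direct_sum_lift I M L g f \<in> carrier L" if "f \<in> carrier (direct_sum I M)" for f
    unfolding direct_sum_lift_def
    using that by (intro L.M.finsum_closed) (auto simp: module_homD(1)[OF g] component_closed)
  have lift_add: "direct_sum_lift I M L g (f \<oplus>\<^bsub>direct_sum I M\<^esub> f') =
      direct_sum_lift I M L g f \<oplus>\<^bsub>L\<^esub> direct_sum_lift I M L g f'"
    if f: "f \<in> carrier (direct_sum I M)" and f': "f' \<in> carrier (direct_sum I M)" for f f'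
  proof -
    let ?S = "{i \<in> I. f i \<noteq> \<zero>\<^bsub>M i\<^esub>} \<union> {i \<in> I. f' i \<noteq> \<zero>\<^bsub>M i\<^esub>}"
    have S: "finite ?S" "?S \<subseteq> I"
      using f f' by (auto simp: carrier_direct_sum)
    have "direct_sum_lift I M L g (f \<oplus>\<^bsub>direct_sum I M\<^esub> f') =
        (\<Oplus>\<^bsub>L\<^esub>i\<in>?S. g i ((f \<oplus>\<^bsub>direct_sum I M\<^esub> f') i))"
      using support_add[OF f f'] S add_closed[OF f f']
      by (intro direct_sum_lift_superset) (auto simp: direct_sum_simps)
    also have "\<dots> = (\<Oplus>\<^bsub>L\<^esub>i\<in>?S. g i (f i) \<oplus>\<^bsub>L\<^esub> g i (f' i))"
      using f f' by (intro L.M.finsum_cong')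
        (auto simp: direct_sum_simps module_homD[OF g] component_closed)
    also have "\<dots> = (\<Oplus>\<^bsub>L\<^esub>i\<in>?S. g i (f i)) \<oplus>\<^bsub>L\<^esub> (\<Oplus>\<^bsub>L\<^esub>i\<in>?S. g i (f' i))"
      using f f' by (intro L.M.finsum_addf) (auto simp: module_homD(1)[OF g] component_closed)
    also have "(\<Oplus>\<^bsub>L\<^esub>i\<in>?S. g i (f i)) = direct_sum_lift I M L g f"
      using S by (intro direct_sum_lift_superset[OF f, symmetric]) auto
    also have "(\<Oplus>\<^bsub>L\<^esub>i\<in>?S. g i (f' i)) = direct_sum_lift I M L g f'"
      using S by (intro direct_sum_lift_superset[OF f', symmetric]) auto
    finally show ?thesis .
  qed
  have "direct_sum_lift I M L g (r \<odot>\<^bsub>direct_sum I M\<^esub> f) = r \<odot>\<^bsub>L\<^esub> direct_sum_lift I M L g f"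
    if r: "r \<in> carrier R" and f: "f \<in> carrier (direct_sum I M)" for r f
    using f
  proof (induction f rule: direct_sum_induct)
    case zero
    have "direct_sum_lift I M L g \<zero>\<^bsub>direct_sum I M\<^esub> = \<zero>\<^bsub>L\<^esub>"
      unfolding direct_sum_simps(1)
      using direct_sum_lift_superset[OF zero_in_direct_sum, of "{}"] by auto
    then show ?case
      using r by (simp add: left_module.smult_zero[OF left_module_direct_sum] L.smult_zero)
  next
    case (inj i x)
    then show ?case
      using r left_module.smult_closed[OF left_modules]
      by (simp add: module_homD(3)[OF inj_hom, symmetric] direct_sum_lift_inj module_homD(3)[OF g])
  next
    case (add f f')
    then show ?case
      using r
      by (simp add: left_module.smult_r_distr[OF left_module_direct_sum] smult_closed closed
          lift_add L.smult_r_distr)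
  qed
  with closed lift_add show ?thesis
    by (auto simp: module_hom_def)
qed

end

end

lemma (in abelian_subgroup) coset_eq_subgroup_iff:
  "x \<in> carrier G \<Longrightarrow> H +> x = H \<longleftrightarrow> x \<in> H"
  using a_coset_join2[OF _ a_subgroup] a_rcos_self by auto

lemma module_hom_comp:
  "\<lbrakk>f \<in> module_hom R M L; g \<in> module_hom R L N\<rbrakk> \<Longrightarrow> (\<lambda>x. g (f x)) \<in> module_hom R M N"
  by (auto simp: module_hom_def Pi_iff)

lemma coset_hom:
  fixes M :: "('r, 'a) module"
  assumes "left_module R M" "submodule K R M"
  shows "(\<lambda>x. K +>\<^bsub>M\<^esub> x) \<in> module_hom R M (quotient_module M K)"
  using add_coset[OF assms] smult_coset[OF assms] left_module.smult_closed[OF assms(1)]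
  by (auto simp: module_hom_def carrier_quotient_module)

lemma module_hom_zero:
  assumes "left_module R M" "left_module R L" "h \<in> module_hom R M L"
  shows "h \<zero>\<^bsub>M\<^esub> = \<zero>\<^bsub>L\<^esub>"
  using assms
  by (intro abelian_group_hom.hom_zero abelian_group_hom_if_additive left_module.axioms(2))
    (auto simp: module_hom_def)

section \<open>Functions supported on the cone\<close>

text \<open>Only the second exponents are restricted to \<open>C\<close>; with \<open>C\<close> the
  lattice points of the cone this becomes induction over \<open>cone_functions\<close>.\<close>

lemma pol_support_induct [consumes 1, case_names zero add monom]:
  fixes h :: "('N::finite, 'k) pol"
  assumes "\<And>a. Poly_Mapping.keys (Poly_Mapping.lookup h a) \<subseteq> C"
    and zero: "P 0" and add: "\<And>p q. \<lbrakk>P p; P q\<rbrakk> \<Longrightarrow> P (p + q)"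
    and monom: "\<And>a k c. k \<in> C \<Longrightarrow> P (pmonom a k c)"
  shows "P h"
proof -
  have P_sum: "(\<And>x. x \<in> S \<Longrightarrow> P (f x)) \<Longrightarrow> P (sum f S)"
    if "finite S" for S and f :: "'z \<Rightarrow> ('N, 'k) pol"
    using that by induction (auto simp: zero add)
  have "P (map_terms pmonom h)"
    unfolding map_terms_def
    by (intro P_sum monom) (use assms(1) in auto)
  then show ?thesis
    by (simp flip: pol_decomp)
qed

lemma pol_induct [case_names zero add monom]:
  fixes h :: "('N::finite, 'k) pol"
  assumes "P 0" "\<And>p q. \<lbrakk>P p; P q\<rbrakk> \<Longrightarrow> P (p + q)" "\<And>a k c. P (pmonom a k c)"
  shows "P h"
  using pol_support_induct[of h UNIV P] assms by auto

section \<open>Lattice points of the cone and nonnegative integer combinations\<close>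

lemma column_in_cone_lattice: "column j A \<in> cone_lattice A"
proof -
  have "(\<chi> i. real_of_int (column j A $ i)) =
      (\<Sum>k\<in>UNIV. of_bool (k = j) *\<^sub>R (\<chi> i. real_of_int (A $ i $ k)))"
    by (simp add: vec_eq_iff column_def of_bool_def if_distrib[of "\<lambda>x. x *\<^sub>R _"]
        if_distrib[of "\<lambda>x. x * _"] cong: if_cong)
  then show ?thesis
    unfolding cone_lattice_def real_cone_def by (auto intro!: exI[of _ "\<lambda>k. of_bool (k = j)"])
qed

lemma cone_lattice_zero: "0 \<in> cone_lattice A"
  unfolding cone_lattice_def real_cone_def
  by (auto simp: vec_eq_iff intro!: exI[of _ "\<lambda>_. 0"])

lemma cone_lattice_add:
  assumes "u \<in> cone_lattice A" "v \<in> cone_lattice A"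
  shows "u + v \<in> cone_lattice A"
proof -
  let ?w = "\<lambda>j. \<chi> i. real_of_int (A $ i $ j)"
  obtain c d where "(\<chi> i. real_of_int (u $ i)) = (\<Sum>j\<in>UNIV. c j *\<^sub>R ?w j)" "\<forall>j. 0 \<le> c j"
    "(\<chi> i. real_of_int (v $ i)) = (\<Sum>j\<in>UNIV. d j *\<^sub>R ?w j)" "\<forall>j. 0 \<le> d j"
    using assms unfolding cone_lattice_def real_cone_def by auto
  moreover have "(\<chi> i. real_of_int ((u + v) $ i)) =
      (\<chi> i. real_of_int (u $ i)) + (\<chi> i. real_of_int (v $ i))"
    by (simp add: vec_eq_iff)
  ultimately have "(\<chi> i. real_of_int ((u + v) $ i)) = (\<Sum>j\<in>UNIV. (c j + d j) *\<^sub>R ?w j)"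
    "\<forall>j. 0 \<le> c j + d j"
    by (simp_all add: sum.distrib scaleR_add_left)
  then show ?thesis
    unfolding cone_lattice_def real_cone_def mem_Collect_eq by (intro exI[of _ "\<lambda>j. c j + d j"] conjI)
qed

lemma nat_comb_zero: "nat_comb A 0 = 0"
  by (simp add: nat_comb_def vec_eq_iff)

lemma nat_comb_add: "nat_comb A (a + b) = nat_comb A a + nat_comb A b"
  by (simp add: nat_comb_def vec_eq_iff distrib_right sum.distrib)

lemma nat_comb_axis: "nat_comb A (axis j 1) = column j A"
proof -
  have "int (axis j 1 $ k) *s column k A = (if k = j then column k A else 0)" for k
    by (simp add: axis_def vec_eq_iff)
  then show ?thesis by (simp add: nat_comb_def)
qed

text \<open>Unit steps from 0 match the recursion \<open>nabla_power_Suc\<close>, so powers of the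
  commuting operators can be treated without unfolding their ordered product.\<close>

lemma nat_vec_induct [case_names zero axis]:
  fixes a :: "(nat, 'N::finite) vec"
  assumes zero: "P 0" and axis: "\<And>a j. P a \<Longrightarrow> P (a + axis j 1)"
  shows "P a"
proof (induction "\<Sum>j\<in>UNIV. a $ j" arbitrary: a)
  case 0
  then have "a = 0" by (simp add: vec_eq_iff)
  with zero show ?case by simp
next
  case (Suc n)
  then obtain j where "a $ j \<noteq> 0" by (metis sum.neutral nat.distinct(1))
  \<comment> \<open>Subtraction of naturals truncates, so the identity depends on
    \<open>a $ j\<close> being nonzero.\<close>
  then have a: "a = (a - axis j 1) + axis j 1"
    by (auto simp: vec_eq_iff axis_def)
  have "(\<Sum>j\<in>UNIV. a $ j) = (\<Sum>k\<in>UNIV. (a - axis j 1) $ k + axis j 1 $ k)"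
    by (subst a) simp
  also have "\<dots> = Suc (\<Sum>k\<in>UNIV. (a - axis j 1) $ k)"
    by (simp only: sum.distrib) (simp add: axis_def)
  finally show ?case
    using Suc axis a by (metis old.nat.inject)
qed

lemma nat_comb_in_cone_lattice: "nat_comb A a \<in> cone_lattice A"
  by (induction a rule: nat_vec_induct)
    (simp_all only: nat_comb_zero nat_comb_add nat_comb_axis cone_lattice_zero cone_lattice_add
      column_in_cone_lattice)

text \<open>The lattice points of the cone form a monoid, so products of the generating monomials
  give no new ones and the generated ring is the span of those monomials. Membership thus becomes a
  condition on supports.\<close>

lemma cone_algebra_iff:
  fixes A :: "int ^ 'N::finite ^ 'n::finite"
  shows "f \<in> cone_algebra A \<longleftrightarrow> Poly_Mapping.keys f \<subseteq> cone_lattice A"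
proof
  show "Poly_Mapping.keys f \<subseteq> cone_lattice A" if "f \<in> cone_algebra A"
    using that
  proof induction
    case (add f g)
    then show ?case using Poly_Mapping.keys_add[of f g] by blast
  next
    case (mult f g)
    then have "{a + b |a b. a \<in> Poly_Mapping.keys f \<and> b \<in> Poly_Mapping.keys g} \<subseteq> cone_lattice A"
      by (auto intro!: cone_lattice_add)
    then show ?case using keys_mult[of f g] by (rule order_trans[rotated])
  qed (auto simp: cone_lattice_zero)
next
  assume f: "Poly_Mapping.keys f \<subseteq> cone_lattice A"
  have single: "Poly_Mapping.single v c \<in> cone_algebra A" if "v \<in> cone_lattice A" for v c
    using cone_algebra.mult[OF cone_algebra.const[of c] cone_algebra.monomial[OF that]]
    by (simp add: mult_single)
  have zero: "0 \<in> cone_algebra A"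
    using cone_algebra.const[of 0 A] by simp
  have sum: "(\<And>v. v \<in> S \<Longrightarrow> F v \<in> cone_algebra A) \<Longrightarrow> sum F S \<in> cone_algebra A"
    if "finite S" for S and F :: "int ^ 'n \<Rightarrow> _"
    using that by induction (auto simp: zero intro: cone_algebra.add)
  have "(\<Sum>v\<in>Poly_Mapping.keys f. Poly_Mapping.single v (Poly_Mapping.lookup f v)) \<in> cone_algebra A"
    using f by (intro sum single) auto
  then show "f \<in> cone_algebra A"
    by (simp only: poly_mapping_sum_monomials)
qed

lemma cone_functions_iff:
  "h \<in> cone_functions A \<longleftrightarrow>
    (\<forall>a. Poly_Mapping.keys (Poly_Mapping.lookup h a) \<subseteq> cone_lattice A)"
  by (simp add: cone_functions_def cone_algebra_iff)

lemma cone_functions_zero [simp]: "0 \<in> cone_functions A"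
  by (simp add: cone_functions_iff)

lemma cone_functions_add:
  "\<lbrakk>p \<in> cone_functions A; q \<in> cone_functions A\<rbrakk> \<Longrightarrow> p + q \<in> cone_functions A"
  unfolding cone_functions_iff lookup_add
  by (meson Poly_Mapping.keys_add Un_least order_trans)

lemma cone_functions_minus: "p \<in> cone_functions A \<Longrightarrow> - p \<in> cone_functions A"
  by (simp add: cone_functions_iff)

lemma cone_functions_monom: "v \<in> cone_lattice A \<Longrightarrow> pmonom a v c \<in> cone_functions A"
  by (auto simp: cone_functions_iff pmonom_def lookup_single when_def split: if_splits)

lemma cone_functions_sum:
  "(\<And>x. x \<in> S \<Longrightarrow> F x \<in> cone_functions A) \<Longrightarrow> sum F S \<in> cone_functions A"
  by (induction S rule: infinite_finite_induct) (auto intro: cone_functions_add)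

lemma cone_functions_induct [consumes 1, case_names zero add monom]:
  assumes "h \<in> cone_functions A" "P 0"
    and "\<And>p q. \<lbrakk>p \<in> cone_functions A; q \<in> cone_functions A; P p; P q\<rbrakk> \<Longrightarrow> P (p + q)"
    and "\<And>a v c. v \<in> cone_lattice A \<Longrightarrow> P (pmonom a v c)"
  shows "P h"
proof -
  have "h \<in> cone_functions A \<and> P h"
    by (rule pol_support_induct[where C = "cone_lattice A"])
      (use assms in \<open>auto simp: cone_functions_monom cone_functions_add\<close>,
        simp add: cone_functions_iff subset_iff)
  then show ?thesis by simp
qed

text \<open>Additivity reduces stability of the cone functions to monomials, where it is a statement
  about exponents.\<close>

lemma cone_functions_additive_closed:
  assumes "\<And>p q. F (p + q) = F p + F q"
    and "\<And>a v c. v \<in> cone_lattice A \<Longrightarrow> F (pmonom a v c) \<in> cone_functions A"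
    and h: "h \<in> cone_functions A"
  shows "F h \<in> cone_functions A"
proof -
  have "F 0 = 0" using assms(1)[of 0 0] by simp
  with h show ?thesis
    by (induction rule: cone_functions_induct) (auto simp: assms cone_functions_add)
qed

lemma cone_functions_monom_mult:
  "\<lbrakk>h \<in> cone_functions A; v \<in> cone_lattice A\<rbrakk> \<Longrightarrow> pmonom a v c * h \<in> cone_functions A"
  by (rule cone_functions_additive_closed[where F = "\<lambda>h. pmonom a v c * h"])
    (auto simp: algebra_simps pmonom_mult intro!: cone_functions_monom cone_lattice_add)

lemma cone_functions_nabla:
  assumes "h \<in> cone_functions A"
  shows "nabla (\<lambda>j. column j A) j h \<in> cone_functions A"
proof -
  \<comment> \<open>Differentiation in x leaves the exponents of t unchanged; the other summand of
    \<open>nabla\<close> adds a column of \<open>A\<close>, which stays in the cone.\<close>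
  have "partial_x j h \<in> cone_functions A"
    using partial_add _ assms
    by (rule cone_functions_additive_closed) (simp only: partial_monom cone_functions_monom)
  moreover have "pmonom 0 (column j A) 1 * h \<in> cone_functions A"
    by (rule cone_functions_monom_mult[OF assms column_in_cone_lattice])
  ultimately show ?thesis
    unfolding nabla_def by (rule cone_functions_add)
qed

section \<open>The action of the Weyl algebra on functions\<close>

lemma nabla_power_invariant:
  assumes "\<And>j h. h \<in> S \<Longrightarrow> nabla y j h \<in> S" and h: "h \<in> S"
  shows "nabla_power y b h \<in> S"
  by (induction b rule: nat_vec_induct) (simp_all only: nabla_power_0 nabla_power_Suc assms)

lemma act_zero_left [simp]: "act y 0 h = 0"
  using act_add_left[of y 0 0 h] by simp

lemma act_zero_right [simp]: "act y P 0 = 0"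
  using act_add_right[of y P 0 0] by simp

lemma act_uminus_right: "act y P (- h) = - act y P h"
  using act_add_right[of y P h "- h"] minus_unique[of "act y P h"] by simp

lemma act_sum_right: "act y P (sum F S) = (\<Sum>x\<in>S. act y P (F x))"
  by (induction S rule: infinite_finite_induct) (auto simp: act_add_right)

lemma act_sum_left: "act y (sum F S) h = (\<Sum>x\<in>S. act y (F x) h)"
  by (induction S rule: infinite_finite_induct) (auto simp: act_add_left)

lemma cone_functions_act:
  assumes "h \<in> cone_functions A"
  shows "act (\<lambda>j. column j A) P h \<in> cone_functions A"
proof (induction P rule: pol_induct)
  case (monom a b c)
  show ?case
    unfolding act_monom
    by (intro cone_functions_monom_mult cone_lattice_zero nabla_power_invariant assms
        cone_functions_nabla)
qed (auto simp: act_add_left cone_functions_add)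

text \<open>No x occurs in t^v, so each derivative vanishes and only the multiplications by t^(w_j)
  remain.\<close>

lemma nabla_power_column:
  "nabla_power (\<lambda>j. column j A) b (pmonom 0 v 1) = pmonom 0 (v + nat_comb A b) 1"
proof (induction b rule: nat_vec_induct)
  case (axis b j)
  then show ?case
    by (simp only: nabla_power_Suc nabla_def partial_const pmonom_mult nat_comb_add nat_comb_axis)
      (simp add: ac_simps)
qed (simp add: nabla_power_0 nat_comb_zero)

text \<open>In normal form the x stand to the left of the derivations and so are never
  differentiated. On t^v the derivations are visible purely as shifts of the exponent.\<close>

lemma act_monom_monom:
  "act (\<lambda>j. column j A) (pmonom a b c) (pmonom 0 v 1) = pmonom a (v + nat_comb A b) c"
  by (simp add: act_monom nabla_power_column pmonom_mult)

section \<open>Twisted derivations\<close>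

lemma t_partial_t_add: "t_partial_t i (p + q) = t_partial_t i p + t_partial_t i q"
  unfolding t_partial_t_def by (rule map_terms_add) (auto simp: pmonom_add algebra_simps)

lemma t_partial_t_monom: "t_partial_t i (pmonom a v c) = pmonom a v (of_int (v $ i) * c)"
  unfolding t_partial_t_def by (rule map_terms_monom) auto

lemma t_partial_t_monom_mult:
  "t_partial_t i (pmonom a v c * h) =
    pmonom a v (of_int (v $ i) * c) * h + pmonom a v c * t_partial_t i h"
  by (rule additive_eqI[where h = h])
    (auto simp: t_partial_t_add t_partial_t_monom pmonom_mult algebra_simps simp flip: pmonom_add)

lemma t_partial_t_partial_x: "t_partial_t i (partial_x j h) = partial_x j (t_partial_t i h)"
  by (rule additive_eqI[where h = h])
    (auto simp: t_partial_t_add t_partial_t_monom partial_add partial_monom ac_simps)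

text \<open>This is t_i d/dt_i applied to the logarithm of t^gamma exp(sum_j x_j t^(w_j)). Isolating
  it writes D_i as a derivation plus multiplication by one element.\<close>

definition twist ::
  "int ^ 'N::finite ^ 'n::finite \<Rightarrow> complex ^ 'n \<Rightarrow> 'n \<Rightarrow> ('N, int ^ 'n) pol"
  where "twist A \<gamma> i = pmonom 0 0 (\<gamma> $ i)
    + (\<Sum>j\<in>UNIV. pmonom (axis j 1) (column j A) (of_int (A $ i $ j)))"

lemma twisted_t_partial_t_twist:
  "twisted_t_partial_t A \<gamma> i h = t_partial_t i h + twist A \<gamma> i * h"
  by (simp add: twisted_t_partial_t_def twist_def algebra_simps sum_distrib_left)

lemma partial_sum: "partial_x j (sum F S) = (\<Sum>x\<in>S. partial_x j (F x))"
proof -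
  have "partial_x j 0 = (0 :: ('a, 'b) pol)" using partial_add[of j 0 0] by simp
  then show ?thesis
    by (induction S rule: infinite_finite_induct) (auto simp: partial_add)
qed

lemma partial_twist:
  "partial_x j (twist A \<gamma> i) = pmonom 0 (column j A) (of_int (A $ i $ j))"
proof -
  have *: "partial_x j (pmonom (axis k 1) (column k A) (of_int (A $ i $ k))) =
      (if k = j then pmonom 0 (column j A) (of_int (A $ i $ j)) else 0)" for k
    by (auto simp: partial_monom axis_def)
  show ?thesis
    by (simp only: twist_def partial_add partial_const partial_sum *) simp
qed

lemma twisted_add:
  "twisted_t_partial_t A \<gamma> i (p + q) = twisted_t_partial_t A \<gamma> i p + twisted_t_partial_t A \<gamma> i q"
  by (simp add: twisted_t_partial_t_twist t_partial_t_add algebra_simps)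

lemma twisted_zero [simp]: "twisted_t_partial_t A \<gamma> i 0 = 0"
  using twisted_add[of A \<gamma> i 0 0] by simp

lemma twisted_uminus: "twisted_t_partial_t A \<gamma> i (- p) = - twisted_t_partial_t A \<gamma> i p"
  by (rule minus_unique[symmetric]) (simp flip: twisted_add)

text \<open>Integrability of the twisted connection: the commutator is multiplication by t_i d/dt_i
  (t^(w_j)) minus the x_j-derivative of \<open>twist\<close>, and both are w_ij t^(w_j).\<close>

lemma twisted_nabla:
  "twisted_t_partial_t A \<gamma> i (nabla (\<lambda>j. column j A) j h) =
    nabla (\<lambda>j. column j A) j (twisted_t_partial_t A \<gamma> i h)"
proof -
  have "column j A $ i = A $ i $ j" by (simp add: column_def)
  then show ?thesis
    by (simp only: twisted_t_partial_t_twist nabla_def partial_add partial_mult t_partial_t_add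
        t_partial_t_monom_mult t_partial_t_partial_x partial_twist mult_1_right)
      (simp add: algebra_simps)
qed

text \<open>Makes each D_i linear over the Weyl algebra, which is why \<open>log_d\<close> is a
  homomorphism and the exact forms are a submodule.\<close>

lemma twisted_act:
  "twisted_t_partial_t A \<gamma> i (act (\<lambda>j. column j A) P h) =
    act (\<lambda>j. column j A) P (twisted_t_partial_t A \<gamma> i h)"
proof (rule additive_eqI[where h = P])
  fix a b c
  have "twisted_t_partial_t A \<gamma> i (nabla_power (\<lambda>j. column j A) b h) =
      nabla_power (\<lambda>j. column j A) b (twisted_t_partial_t A \<gamma> i h)"
    by (induction b rule: nat_vec_induct) (simp_all only: nabla_power_0 nabla_power_Suc twisted_nabla)
  \<comment> \<open>D_i differentiates only in t, so multiplication by a polynomial in x passes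
    through it.\<close>
  moreover have "twisted_t_partial_t A \<gamma> i (pmonom a 0 c * g) =
      pmonom a 0 c * twisted_t_partial_t A \<gamma> i g" for g
    by (simp only: twisted_t_partial_t_twist t_partial_t_monom_mult) (simp add: algebra_simps)
  ultimately show "twisted_t_partial_t A \<gamma> i (act (\<lambda>j. column j A) (pmonom a b c) h) =
      act (\<lambda>j. column j A) (pmonom a b c) (twisted_t_partial_t A \<gamma> i h)"
    by (simp only: act_monom)
qed (auto simp: act_add_left twisted_add)

text \<open>Source of the parameter gamma + v: t_i d/dt_i contributes v_i next to gamma_i, so x^a
  t^v meets the Euler operator of the module at \<open>v\<close>.\<close>

lemma twisted_monom:
  "twisted_t_partial_t A \<gamma> i (pmonom a v c) = pmonom a v (shift \<gamma> v $ i * c)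
    + (\<Sum>j\<in>UNIV. pmonom (a + axis j 1) (v + column j A) (of_int (A $ i $ j) * c))"
  by (simp only: twisted_t_partial_t_twist twist_def t_partial_t_monom distrib_right
      sum_distrib_right pmonom_mult shift_def)
    (simp add: algebra_simps pmonom_add)

lemma cone_functions_twisted:
  assumes "h \<in> cone_functions A"
  shows "twisted_t_partial_t A \<gamma> i h \<in> cone_functions A"
  using twisted_add _ assms
  by (rule cone_functions_additive_closed[where F = "twisted_t_partial_t A \<gamma> i"])
    (auto simp: twisted_monom intro!: cone_functions_add cone_functions_sum cone_functions_monom
      cone_lattice_add column_in_cone_lattice)

section \<open>Logarithmic forms\<close>

lemma log_forms_simps:
  "carrier (log_forms A q) = {\<omega>. \<forall>I. \<omega> I \<in> cone_functions A \<and> (card I \<noteq> q \<longrightarrow> \<omega> I = 0)}"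
  "\<zero>\<^bsub>log_forms A q\<^esub> = (\<lambda>I. 0)" "\<omega> \<oplus>\<^bsub>log_forms A q\<^esub> \<eta> = (\<lambda>I. \<omega> I + \<eta> I)"
  "P \<odot>\<^bsub>log_forms A q\<^esub> \<omega> = (\<lambda>I. act (\<lambda>j. column j A) P (\<omega> I))"
  by (simp_all add: log_forms_def)

lemma weyl_simps [simp]:
  "carrier weyl_algebra = UNIV" "P \<oplus>\<^bsub>weyl_algebra\<^esub> Q = P + Q" "P \<otimes>\<^bsub>weyl_algebra\<^esub> Q = P \<star> Q"
  "\<one>\<^bsub>weyl_algebra\<^esub> = 1"
  "carrier weyl_module = UNIV" "P \<oplus>\<^bsub>weyl_module\<^esub> Q = P + Q" "P \<odot>\<^bsub>weyl_module\<^esub> Q = P \<star> Q"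
  "\<zero>\<^bsub>weyl_module\<^esub> = 0"
  by (simp_all add: weyl_algebra_def weyl_module_def)

lemma left_module_log_forms: "left_module weyl_algebra (log_forms A q)"
proof -
  have "abelian_group (log_forms A q)"
  proof (rule abelian_groupI, goal_cases)
    case (6 \<omega>)
    then show ?case
      by (intro bexI[of _ "\<lambda>I. - \<omega> I"]) (auto simp: log_forms_simps cone_functions_minus)
  qed (auto simp: log_forms_simps cone_functions_add algebra_simps)
  then show ?thesis
    by (intro left_module.intro left_module_axioms.intro ring_weyl_algebra)
      (auto simp: log_forms_simps cone_functions_act act_add_left act_add_right act_weyl_mult act_one)
qed

lemma left_module_weyl: "left_module weyl_algebra weyl_module"
proof -
  have "abelian_group weyl_module"
    by (rule abelian_groupI) (auto simp: algebra_simps intro: exI[of _ "- x" for x])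
  then show ?thesis
    by (intro left_module.intro left_module_axioms.intro ring_weyl_algebra)
      (auto simp: weyl_mult_def act_add_left act_add_right act_weyl_mult[unfolded weyl_mult_def] act_one
        simp del: One_nat_def)
qed

lemma minus_one_power_cases: "(- 1) ^ k * h = h \<or> (- 1) ^ k * h = - (h :: 'a::ring_1)"
  by (cases "even k") auto

lemma log_d_hom:
  fixes A :: "int ^ 'N::{finite,linorder} ^ 'n::{finite,linorder}"
  shows "log_d A \<gamma> \<in> module_hom weyl_algebra (log_forms A q) (log_forms A (Suc q))"
proof -
  have sign: "(- 1) ^ k * h \<in> cone_functions A" if "h \<in> cone_functions A" for k h
    using minus_one_power_cases[of k h] that by (auto simp: cone_functions_minus)
  have act_sign: "act (\<lambda>j. column j A) P ((- 1) ^ k * h) = (- 1) ^ k * act (\<lambda>j. column j A) P h"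
    for P k and h :: "('N, int ^ 'n::{finite,linorder}) pol"
    by (cases "even k") (auto simp: act_uminus_right)
  \<comment> \<open>Each \<open>J - {i}\<close> has one element less than \<open>J\<close>, so no
    term survives outside degree \<open>Suc q\<close>.\<close>
  have "log_d A \<gamma> \<omega> J = 0"
    if "\<forall>I. card I \<noteq> q \<longrightarrow> \<omega> I = 0" "card J \<noteq> Suc q" for \<omega> J
  proof -
    have "card (J - {i}) \<noteq> q" if "i \<in> J" for i
      using \<open>card J \<noteq> Suc q\<close> that card_Suc_Diff1[of J i] by auto
    moreover have "twisted_t_partial_t A \<gamma> i 0 = 0" for i
      using twisted_add[of A \<gamma> i 0 0] by simp
    ultimately show ?thesis
      using that(1) by (simp add: log_d_def)
  qed
  then show ?thesis
    by (auto simp: module_hom_def log_forms_simps log_d_def twisted_add distrib_left sum.distrib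
        twisted_act act_sum_right act_sign fun_eq_iff
        intro!: cone_functions_sum sign cone_functions_twisted)
qed

declare One_nat_def [simp del]

section \<open>The hypergeometric ideals\<close>

lemma weyl_mult_distrib:
  "P \<star> (Q + Q') = P \<star> Q + P \<star> Q'" "(P + P') \<star> Q = P \<star> Q + P' \<star> Q"
  "P \<star> (Q - Q') = P \<star> Q - P \<star> Q'" "(P - P') \<star> Q = P \<star> Q - P' \<star> Q" "0 \<star> Q = 0"
proof -
  show add: "P \<star> (Q + Q') = P \<star> Q + P \<star> Q'" "(P + P') \<star> Q = P \<star> Q + P' \<star> Q" for P P' Q Q'
    by (simp_all only: weyl_mult_def act_add_left act_add_right)
  show "P \<star> (Q - Q') = P \<star> Q - P \<star> Q'" "(P - P') \<star> Q = P \<star> Q - P' \<star> Q"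
    using add(1)[of P "Q - Q'" Q'] add(2)[of "P - P'" P' Q] by (simp_all add: algebra_simps)
  show "0 \<star> Q = 0" by (simp add: weyl_mult_def)
qed

lemma weyl_mult_assoc: "P \<star> Q \<star> S = P \<star> (Q \<star> S)"
  by (simp only: weyl_mult_def act_weyl_mult[unfolded weyl_mult_def])

lemma nabla_power_axis: "nabla_power (\<lambda>j. axis j 1) b (pmonom 0 v 1) = pmonom 0 (v + b) 1"
proof (induction b rule: nat_vec_induct)
  case (axis b j)
  then show ?case
    by (simp only: nabla_power_Suc nabla_def partial_const pmonom_mult) (simp add: ac_simps)
qed (simp add: nabla_power_0)

text \<open>In normal form the derivations stand on the right, so appending more of them requires no
  commutation. Right multiplication by \<open>d_power\<close> thereby becomes ordinary polynomial
  algebra on symbols.\<close>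

lemma weyl_mult_d_power: "P \<star> d_power b = P * d_power b"
  unfolding weyl_mult_def d_power_def
proof (rule additive_eqI[where h = P])
  fix a k c
  show "act (\<lambda>j. axis j 1) (pmonom a k c) (pmonom 0 b 1) = pmonom a k c * pmonom 0 b 1"
    by (simp only: act_monom nabla_power_axis pmonom_mult) (simp add: ac_simps)
qed (auto simp: act_add_left algebra_simps)

lemma x_weyl_mult: "pmonom a 0 c \<star> Q = pmonom a 0 c * Q"
  by (simp add: weyl_mult_def act_monom nabla_power_0)

lemma d_power_add: "d_power (a + b) = d_power a * d_power b"
  by (simp add: d_power_def pmonom_mult)

lemma d_power_zero: "d_power 0 = 1"
  by (simp add: d_power_def pmonom_one)

lemma a_inv_weyl: "\<ominus>\<^bsub>weyl_module\<^esub> P = - P"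
  using abelian_group.minus_equality[of weyl_module "- P" P] left_module.axioms(2)[OF left_module_weyl]
  by simp

lemma hyp_ideal_submodule: "submodule (hyp_ideal A \<beta>) weyl_algebra weyl_module"
  unfolding hyp_ideal_def by (rule submodule_span[OF left_module_weyl]) simp

lemma hyp_ideal_left: "Q \<in> hyp_ideal A \<beta> \<Longrightarrow> P \<star> Q \<in> hyp_ideal A \<beta>"
  using submoduleD(5)[OF hyp_ideal_submodule, of P Q A \<beta>] by simp

lemma euler_in_hyp_ideal: "euler_op A \<beta> i \<in> hyp_ideal A \<beta>"
  unfolding hyp_ideal_def by (rule subsetD[OF submodule_span_incl]) simp

lemma box_in_hyp_ideal:
  "(\<Sum>j\<in>UNIV. l $ j *s column j A) = 0 \<Longrightarrow> box_op l \<in> hyp_ideal A \<beta>"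
  unfolding hyp_ideal_def by (rule subsetD[OF submodule_span_incl]) auto

text \<open>The box relations identify any two monomials in the derivations of equal weight, which
  makes the transition maps independent of the chosen exponents.\<close>

lemma d_power_diff_in_hyp_ideal:
  fixes A :: "int ^ 'N::{finite,linorder} ^ 'n::finite"
  assumes "nat_comb A a = nat_comb A b"
  shows "d_power a - d_power b \<in> hyp_ideal A \<beta>"
proof -
  define l :: "(int, 'N) vec" where "l = (\<chi> j. int (a $ j) - int (b $ j))"
  \<comment> \<open>\<open>m\<close> is the greatest common divisor of the two monomials; dividing
    by it leaves exactly the positive and negative parts of \<open>l\<close>, that is
    \<open>box_op l\<close>.\<close>
  define m :: "(nat, 'N) vec" where "m = (\<chi> j. min (a $ j) (b $ j))"
  have "(\<Sum>j\<in>UNIV. l $ j *s column j A) = nat_comb A a - nat_comb A b"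
    by (simp add: nat_comb_def l_def vec_eq_iff left_diff_distrib sum_subtractf)
  then have "box_op l \<in> hyp_ideal A \<beta>"
    using assms by (intro box_in_hyp_ideal) simp
  then have "d_power m \<star> box_op l \<in> hyp_ideal A \<beta>"
    by (rule hyp_ideal_left)
  moreover have "m + (\<chi> j. nat (l $ j)) = a" "m + (\<chi> j. nat (- l $ j)) = b"
    by (auto simp: vec_eq_iff m_def l_def)
  then have "d_power m \<star> box_op l = d_power a - d_power b"
    by (simp add: box_op_def weyl_mult_distrib weyl_mult_d_power flip: d_power_add)
  ultimately show ?thesis by simp
qed

lemma euler_op_monoms:
  "euler_op A \<beta> i =
    (\<Sum>j\<in>UNIV. pmonom (axis j 1) (axis j 1) (of_int (A $ i $ j))) + pmonom 0 0 (\<beta> $ i)"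
  unfolding euler_op_def x_op_def d_op_def scalar_op_def[symmetric] pmonom_normal_form[symmetric] ..

lemma d_mult: "d_power (axis j 1) \<star> P = partial_x j P + P \<star> d_power (axis j 1)"
  unfolding weyl_mult_d_power
  using act_generators(1)[of j P] by (simp add: d_op_def nabla_def d_power_def mult.commute)

lemma partial_euler: "partial_x j (euler_op A \<beta> i) = pmonom 0 (axis j 1) (of_int (A $ i $ j))"
proof -
  have *: "partial_x j (pmonom (axis k 1) (axis k 1) (of_int (A $ i $ k))) =
      (if k = j then pmonom 0 (axis j 1) (of_int (A $ i $ j)) else 0)" for k
    by (auto simp: partial_monom axis_def)
  show ?thesis
    by (simp only: euler_op_monoms partial_add partial_const partial_sum *) simp
qed

text \<open>Commuting d_j past x_j d_j produces an extra d_j; weighted by w_ij this is exactly the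
  difference between the parameters at \<open>v + column j A\<close> and at
  \<open>v\<close>.\<close>

lemma euler_op_shift:
  "euler_op A (shift \<gamma> (v + column j A)) i \<star> d_power (axis j 1) =
    d_power (axis j 1) \<star> euler_op A (shift \<gamma> v) i"
proof -
  have "shift \<gamma> (v + column j A) $ i = shift \<gamma> v $ i + of_int (A $ i $ j)"
    by (simp add: shift_def column_def)
  then have "euler_op A (shift \<gamma> (v + column j A)) i =
      euler_op A (shift \<gamma> v) i + pmonom 0 0 (of_int (A $ i $ j))"
    by (simp only: euler_op_monoms pmonom_add add.assoc)
  then show ?thesis
    by (simp add: d_mult partial_euler weyl_mult_distrib)
      (simp add: d_power_def x_weyl_mult pmonom_mult)
qed

text \<open>The operators whose product with d_j lands in the target ideal form a left ideal, so
  only generators matter: Euler operators pass by \<open>euler_op_shift\<close>, box operators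
  because they commute with d_j.\<close>

lemma hyp_ideal_right_d:
  assumes "P \<in> hyp_ideal A (shift \<gamma> (v + column j A))"
  shows "P \<star> d_power (axis j 1) \<in> hyp_ideal A (shift \<gamma> v)"
proof -
  let ?K = "{P. P \<star> d_power (axis j 1) \<in> hyp_ideal A (shift \<gamma> v)}"
  have "submodule ?K weyl_algebra weyl_module"
    using submoduleD(2,3)[OF hyp_ideal_submodule[of A "shift \<gamma> v"]]
    by (intro left_module.submoduleI[OF left_module_weyl])
      (auto simp: weyl_mult_distrib weyl_mult_assoc hyp_ideal_left)
  moreover have "euler_op A (shift \<gamma> (v + column j A)) i \<in> ?K" for i
    by (simp add: euler_op_shift hyp_ideal_left euler_in_hyp_ideal)
  moreover have "box_op l \<in> ?K" if "(\<Sum>j\<in>UNIV. l $ j *s column j A) = 0" for l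
  proof -
    have "box_op l \<star> d_power (axis j 1) = d_power (axis j 1) \<star> box_op l"
      unfolding box_op_def weyl_mult_distrib weyl_mult_d_power by (simp add: algebra_simps)
    then show ?thesis
      using that by (simp only: mem_Collect_eq hyp_ideal_left box_in_hyp_ideal)
  qed
  ultimately have "hyp_ideal A (shift \<gamma> (v + column j A)) \<subseteq> ?K"
    unfolding hyp_ideal_def[of _ "shift \<gamma> (v + _)"] by (intro submodule_span_minimal) auto
  with assms show ?thesis by auto
qed

lemma hyp_ideal_right_d_power:
  "P \<in> hyp_ideal A (shift \<gamma> (v + nat_comb A a)) \<Longrightarrow> P \<star> d_power a \<in> hyp_ideal A (shift \<gamma> v)"
proof (induction a arbitrary: P rule: nat_vec_induct)
  case zero
  then show ?case
    by (simp add: nat_comb_zero d_power_zero weyl_mult_one)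
next
  case (axis a j)
  then have "P \<in> hyp_ideal A (shift \<gamma> (v + nat_comb A a + column j A))"
    by (simp only: nat_comb_add nat_comb_axis add.assoc)
  then have "P \<star> d_power (axis j 1) \<star> d_power a \<in> hyp_ideal A (shift \<gamma> v)"
    by (intro axis.IH hyp_ideal_right_d)
  moreover have "P \<star> d_power (axis j 1) \<star> d_power a = P \<star> d_power (a + axis j 1)"
    unfolding weyl_mult_d_power unfolding d_power_add by (simp only: ac_simps)
  ultimately show ?case by simp
qed

lemma left_module_hyp_module: "left_module weyl_algebra (hyp_module A \<beta>)"
  unfolding hyp_module_def by (rule left_module_quotient[OF left_module_weyl hyp_ideal_submodule])

lemma hyp_abelian_subgroup: "abelian_subgroup (hyp_ideal A \<beta>) weyl_module"
  by (rule left_module.abelian_subgroup_submodule[OF left_module_weyl hyp_ideal_submodule])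

lemma hyp_coset_eq_iff:
  "hyp_ideal A \<beta> +>\<^bsub>weyl_module\<^esub> P = hyp_ideal A \<beta> +>\<^bsub>weyl_module\<^esub> Q \<longleftrightarrow> P - Q \<in> hyp_ideal A \<beta>"
  using abelian_subgroup.coset_eq_iff[OF hyp_abelian_subgroup, of P Q A \<beta>]
  by (simp add: a_minus_def a_inv_weyl)

text \<open>Replaces the exponent hidden in \<open>SOME\<close> by any convenient one; the two
  results differ by a left multiple of \<open>d_power a - d_power b\<close>.\<close>

lemma hyp_transition_coset:
  assumes "v1 - v2 = nat_comb A b"
  shows "hyp_transition A \<gamma> v1 v2 (hyp_ideal A (shift \<gamma> v1) +>\<^bsub>weyl_module\<^esub> P) =
    hyp_ideal A (shift \<gamma> v2) +>\<^bsub>weyl_module\<^esub> (P \<star> d_power b)"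
proof -
  define a where "a = (SOME a. v1 - v2 = nat_comb A a)"
  have a: "v1 - v2 = nat_comb A a"
    unfolding a_def by (rule someI) (rule assms)
  then have v1: "v1 = v2 + nat_comb A a" by (simp add: algebra_simps)
  have "abelian_group_hom weyl_module weyl_module (\<lambda>P. P \<star> d_power a)"
    using left_module.axioms(2)[OF left_module_weyl]
    by (intro abelian_group_hom_if_additive) (auto simp: weyl_mult_distrib)
  then have "hyp_transition A \<gamma> v1 v2 (hyp_ideal A (shift \<gamma> v1) +>\<^bsub>weyl_module\<^esub> P) =
      hyp_ideal A (shift \<gamma> v2) +>\<^bsub>weyl_module\<^esub> (P \<star> d_power a)"
    unfolding hyp_transition_def a_def[symmetric]
    by (intro coset_map_coset hyp_abelian_subgroup) (auto simp: v1 hyp_ideal_right_d_power)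
  also have "\<dots> = hyp_ideal A (shift \<gamma> v2) +>\<^bsub>weyl_module\<^esub> (P \<star> d_power b)"
    using a assms
    by (auto simp: hyp_coset_eq_iff hyp_ideal_left d_power_diff_in_hyp_ideal
        simp flip: weyl_mult_distrib)
  finally show ?thesis .
qed

section \<open>The colimit and the top cohomology\<close>

text \<open>Stands for \<open>h\<close> times the invariant volume form, the wedge of all
  dt_i/t_i.\<close>

definition top_form :: "('N, int ^ 'n) pol \<Rightarrow> 'n::finite set \<Rightarrow> ('N, int ^ 'n) pol"
  where "top_form h I = (if I = UNIV then h else 0)"

definition exact_forms ::
  "int ^ 'N::{finite,linorder} ^ 'n::{finite,linorder} \<Rightarrow> complex ^ 'n::{finite,linorder} \<Rightarrow>
    ('n set \<Rightarrow> ('N, int ^ 'n::{finite,linorder}) pol) set"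
  where "exact_forms A \<gamma> = log_d A \<gamma> ` carrier (log_forms A (CARD('n) - 1))"

definition top_cohomology ::
  "int ^ 'N::{finite,linorder} ^ 'n::{finite,linorder} \<Rightarrow> complex ^ 'n::{finite,linorder} \<Rightarrow>
    ('N diff_op, ('n set \<Rightarrow> ('N, int ^ 'n::{finite,linorder}) pol) set) module"
  where "top_cohomology A \<gamma> = quotient_module (log_forms A CARD('n)) (exact_forms A \<gamma>)"

lemma card_eq_UNIV_iff: "card (I :: 'a::finite set) = CARD('a) \<longleftrightarrow> I = UNIV"
  using card_subset_eq[of UNIV I] by auto

lemma exact_forms_submodule:
  fixes A :: "int ^ 'N::{finite,linorder} ^ 'n::{finite,linorder}"
  shows "submodule (exact_forms A \<gamma>) weyl_algebra (log_forms A CARD('n))"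
  using left_module.submodule_image[OF left_module_log_forms left_module_log_forms log_d_hom,
      of A \<gamma> "CARD('n) - 1"]
  by (simp add: exact_forms_def)

lemma left_module_top_cohomology: "left_module weyl_algebra (top_cohomology A \<gamma>)"
  unfolding top_cohomology_def
  by (rule left_module_quotient[OF left_module_log_forms exact_forms_submodule])

text \<open>No index set has more than n elements, so every n-form is closed and the top cohomology
  is a plain cokernel.\<close>

lemma cohomology_top:
  fixes A :: "int ^ 'N::{finite,linorder} ^ 'n::{finite,linorder}"
  shows "cohomology (log_forms A) (log_d A \<gamma>) CARD('n) = top_cohomology A \<gamma>"
proof -
  have "log_d A \<gamma> \<omega> = (\<lambda>I. 0)" if "\<omega> \<in> carrier (log_forms A CARD('n))" for \<omega>
  proof
    fix J
    have "\<omega> (J - {i}) = 0" if "i \<in> J" for i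
      using \<open>\<omega> \<in> _\<close> that card_eq_UNIV_iff[of "J - {i}"] by (auto simp: log_forms_simps)
    then show "log_d A \<gamma> \<omega> J = 0"
      by (simp add: log_d_def)
  qed
  then have "(log_forms A CARD('n))\<lparr>carrier := {\<omega> \<in> carrier (log_forms A CARD('n)).
      log_d A \<gamma> \<omega> = \<zero>\<^bsub>log_forms A (Suc CARD('n))\<^esub>}\<rparr> = log_forms A CARD('n)"
    by (simp add: log_forms_simps(2) cong: conj_cong)
  \<comment> \<open>Index types are nonempty, so n is positive and the successor case of
    \<open>cohomology\<close> applies, with \<open>p\<close> equal to n - 1.\<close>
  moreover obtain p where "CARD('n) = Suc p"
    using zero_less_card_finite[where 'a = 'n] by (metis gr0_implies_Suc)
  ultimately show ?thesis
    by (simp add: cohomology_def top_cohomology_def exact_forms_def)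
qed

lemma top_form_in_log_forms:
  fixes A :: "int ^ 'N::{finite,linorder} ^ 'n::finite"
  shows "h \<in> cone_functions A \<Longrightarrow> top_form h \<in> carrier (log_forms A CARD('n))"
  by (auto simp: log_forms_simps top_form_def)

lemma log_forms_top:
  fixes A :: "int ^ 'N::{finite,linorder} ^ 'n::finite"
  assumes "\<omega> \<in> carrier (log_forms A CARD('n))"
  shows "\<omega> UNIV \<in> cone_functions A" "\<omega> = top_form (\<omega> UNIV)"
  using assms by (auto simp: log_forms_simps top_form_def fun_eq_iff card_eq_UNIV_iff)

text \<open>Forms of degree n - 1 are indexed by the complements of single indices, and the signs of
  \<open>log_d\<close> can be moved into the coefficients since D_i is additive. With
  \<open>twisted_exact\<close> this identifies exact top forms with sums of values of the
  D_i.\<close>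

lemma exact_top_form_decomp:
  fixes A :: "int ^ 'N::{finite,linorder} ^ 'n::{finite,linorder}"
  assumes "top_form h \<in> exact_forms A \<gamma>"
  shows "\<exists>H. (\<forall>i. H i \<in> cone_functions A) \<and> h = (\<Sum>i\<in>UNIV. twisted_t_partial_t A \<gamma> i (H i))"
proof -
  obtain \<eta> where \<eta>: "\<eta> \<in> carrier (log_forms A (CARD('n) - 1))" "top_form h = log_d A \<gamma> \<eta>"
    using assms by (auto simp: exact_forms_def)
  define H where "H i = (- 1) ^ card {k \<in> UNIV. k < i} * \<eta> (UNIV - {i})" for i
  have "H i \<in> cone_functions A" for i
    using \<eta>(1) minus_one_power_cases[of "card {k \<in> UNIV. k < i}" "\<eta> (UNIV - {i})"]
    by (auto simp: H_def log_forms_simps cone_functions_minus)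
  moreover have "twisted_t_partial_t A \<gamma> i ((- 1) ^ k * p) = (- 1) ^ k * twisted_t_partial_t A \<gamma> i p"
    for i k p
    by (cases "even k") (auto simp: twisted_uminus)
  then have "h = (\<Sum>i\<in>UNIV. twisted_t_partial_t A \<gamma> i (H i))"
    using fun_cong[OF \<eta>(2), of UNIV] by (simp add: top_form_def log_d_def H_def)
  ultimately show ?thesis by blast
qed

lemma twisted_exact:
  fixes A :: "int ^ 'N::{finite,linorder} ^ 'n::{finite,linorder}"
  assumes h: "h \<in> cone_functions A"
  shows "top_form (twisted_t_partial_t A \<gamma> i h) \<in> exact_forms A \<gamma>"
proof -
  let ?s = "(- 1) ^ card {k \<in> UNIV. k < i} :: ('N, int ^ 'n::{finite,linorder}) pol"
  \<comment> \<open>Supported on the complement of \<open>i\<close>, with the sign that cancels the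
    one in \<open>log_d\<close> at \<open>UNIV\<close>.\<close>
  define \<eta> where "\<eta> I = (if I = UNIV - {i} then ?s * h else 0)" for I
  have "?s * h \<in> cone_functions A"
    using h minus_one_power_cases[of "card {k \<in> UNIV. k < i}" h] by (auto simp: cone_functions_minus)
  then have "\<eta> \<in> carrier (log_forms A (CARD('n) - 1))"
    by (auto simp: log_forms_simps \<eta>_def card_Diff_singleton)
  moreover have "log_d A \<gamma> \<eta> = top_form (twisted_t_partial_t A \<gamma> i h)"
  proof
    fix J :: "'n set"
    have *: "(- 1) ^ card {l \<in> J. l < k} * twisted_t_partial_t A \<gamma> k (\<eta> (J - {k})) =
        (if k = i then top_form (twisted_t_partial_t A \<gamma> i h) J else 0)" if "k \<in> J" for k
    proof (cases "J - {k} = UNIV - {i}")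
      case True
      then have "J = UNIV" "k = i" using that by auto
      then show ?thesis
        by (cases "even (card {k \<in> UNIV. k < i})") (auto simp: \<eta>_def top_form_def twisted_uminus)
    next
      case False
      then have "k \<noteq> i \<or> J \<noteq> UNIV" by auto
      with False show ?thesis by (auto simp: \<eta>_def top_form_def)
    qed
    have "log_d A \<gamma> \<eta> J = (\<Sum>k\<in>J. if k = i then top_form (twisted_t_partial_t A \<gamma> i h) J else 0)"
      unfolding log_d_def by (intro sum.cong refl *)
    then show "log_d A \<gamma> \<eta> J = top_form (twisted_t_partial_t A \<gamma> i h) J"
      by (auto simp: top_form_def)
  qed
  ultimately show ?thesis
    unfolding exact_forms_def by (metis imageI)
qed

section \<open>The map into the top cohomology from a single module\<close>

definition act_on_monomial ::
  "int ^ 'N::{finite,linorder} ^ 'n::{finite,linorder} \<Rightarrow> complex ^ 'n::{finite,linorder} \<Rightarrow>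
    int ^ 'n::{finite,linorder} \<Rightarrow> 'N diff_op \<Rightarrow> ('n set \<Rightarrow> ('N, int ^ 'n::{finite,linorder}) pol) set"
  where "act_on_monomial A \<gamma> v P =
    exact_forms A \<gamma> +>\<^bsub>log_forms A CARD('n)\<^esub> top_form (act (\<lambda>j. column j A) P (pmonom 0 v 1))"

lemma act_on_monomial_hom:
  fixes A :: "int ^ 'N::{finite,linorder} ^ 'n::{finite,linorder}"
  assumes v: "v \<in> cone_lattice A"
  shows "act_on_monomial A \<gamma> v \<in> module_hom weyl_algebra weyl_module (top_cohomology A \<gamma>)"
proof -
  have "(\<lambda>P. top_form (act (\<lambda>j. column j A) P (pmonom 0 v 1)))
      \<in> module_hom weyl_algebra weyl_module (log_forms A CARD('n))"
    using v by (auto simp: module_hom_def act_weyl_mult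
        intro!: top_form_in_log_forms cone_functions_act cone_functions_monom)
      (auto simp: log_forms_simps top_form_def act_add_left fun_eq_iff)
  then show ?thesis
    unfolding act_on_monomial_def[abs_def] top_cohomology_def
    by (rule module_hom_comp[OF _ coset_hom[OF left_module_log_forms exact_forms_submodule]])
qed

lemma top_form_coset_zero_iff:
  assumes "h \<in> cone_functions A"
  shows "exact_forms A \<gamma> +>\<^bsub>log_forms A CARD('n::{finite,linorder})\<^esub> top_form h =
      \<zero>\<^bsub>top_cohomology A (\<gamma> :: complex ^ 'n::{finite,linorder})\<^esub> \<longleftrightarrow> top_form h \<in> exact_forms A \<gamma>"
  using abelian_subgroup.coset_eq_subgroup_iff[OF left_module.abelian_subgroup_submodule[OF
        left_module_log_forms exact_forms_submodule] top_form_in_log_forms[OF assms]]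
  by (simp add: top_cohomology_def)

lemma top_form_coset_zero:
  "exact_forms A \<gamma> +>\<^bsub>log_forms A CARD('n::{finite,linorder})\<^esub> top_form 0 =
      \<zero>\<^bsub>top_cohomology A (\<gamma> :: complex ^ 'n::{finite,linorder})\<^esub>"
  using twisted_exact[of 0 A \<gamma>] by (simp add: top_form_coset_zero_iff)

text \<open>The kernel is a left ideal, so it is enough to treat generators. Euler operators give
  exact forms, whereas box operators kill t^v itself, before any passage to cohomology.\<close>

lemma act_on_monomial_ideal:
  assumes v: "v \<in> cone_lattice A" and P: "P \<in> hyp_ideal A (shift \<gamma> v)"
  shows "act_on_monomial A \<gamma> v P = \<zero>\<^bsub>top_cohomology A \<gamma>\<^esub>"
proof -
  let ?K = "{P \<in> carrier weyl_module. act_on_monomial A \<gamma> v P = \<zero>\<^bsub>top_cohomology A \<gamma>\<^esub>}"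
  have K: "submodule ?K weyl_algebra weyl_module"
    by (rule left_module.submodule_kernel[OF left_module_weyl left_module_top_cohomology
          act_on_monomial_hom[OF v]])
  have "act (\<lambda>j. column j A) (euler_op A (shift \<gamma> v) i) (pmonom 0 v 1) =
      twisted_t_partial_t A \<gamma> i (pmonom 0 v 1)" for i
    by (simp add: euler_op_monoms twisted_monom act_add_left act_sum_left act_monom_monom
        nat_comb_axis nat_comb_zero add.commute)
  then have "euler_op A (shift \<gamma> v) i \<in> ?K" for i
    using v by (simp add: act_on_monomial_def top_form_coset_zero_iff cone_functions_twisted
        cone_functions_monom twisted_exact)
  moreover have "box_op l \<in> ?K" if "(\<Sum>j\<in>UNIV. l $ j *s column j A) = 0" for l
  proof -
    \<comment> \<open>The two exponent vectors are the positive and negative parts of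
      \<open>l\<close>, so their difference is \<open>l\<close>, and both monomials in the
      derivations send t^v to the same monomial.\<close>
    have "nat_comb A (\<chi> j. nat (l $ j)) - nat_comb A (\<chi> j. nat (- l $ j)) =
        (\<Sum>j\<in>UNIV. l $ j *s column j A)"
      unfolding nat_comb_def sum_subtractf[symmetric]
      by (intro sum.cong refl) (auto simp: vec_eq_iff)
    with that have "nat_comb A (\<chi> j. nat (l $ j)) = nat_comb A (\<chi> j. nat (- l $ j))"
      by simp
    then have "act (\<lambda>j. column j A) (d_power (\<chi> j. nat (l $ j))) (pmonom 0 v 1) =
        act (\<lambda>j. column j A) (d_power (\<chi> j. nat (- l $ j))) (pmonom 0 v 1)"
      by (simp add: d_power_def act_monom_monom)
    then have "act (\<lambda>j. column j A) (box_op l) (pmonom 0 v 1) = 0"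
      using act_add_left[of "\<lambda>j. column j A" "box_op l" "d_power (\<chi> j. nat (- l $ j))"]
      by (simp add: box_op_def)
    then show ?thesis
      by (simp add: act_on_monomial_def top_form_coset_zero)
  qed
  ultimately have "hyp_ideal A (shift \<gamma> v) \<subseteq> ?K"
    unfolding hyp_ideal_def by (intro submodule_span_minimal K) auto
  with P show ?thesis by auto
qed

section \<open>Classes in the colimit\<close>

abbreviation hyp_sum ::
  "int ^ 'N::{finite,linorder} ^ 'n::finite \<Rightarrow> complex ^ 'n \<Rightarrow>
    ('N diff_op, int ^ 'n \<Rightarrow> 'N diff_op set) module"
  where "hyp_sum A \<gamma> \<equiv> direct_sum (cone_lattice A) (\<lambda>v. hyp_module A (shift \<gamma> v))"

abbreviation hyp_relations ::
  "int ^ 'N::{finite,linorder} ^ 'n::finite \<Rightarrow> complex ^ 'n \<Rightarrow> (int ^ 'n \<Rightarrow> 'N diff_op set) set"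
  where "hyp_relations A \<gamma> \<equiv> colimit_relations weyl_algebra (cone_lattice A) (cone_le A)
    (\<lambda>v. hyp_module A (shift \<gamma> v)) (hyp_transition A \<gamma>)"

text \<open>The canonical map from the module at \<open>v\<close> to the colimit, evaluated on the
  class of \<open>P\<close>.\<close>

definition hyp_class ::
  "int ^ 'N::{finite,linorder} ^ 'n::finite \<Rightarrow> complex ^ 'n \<Rightarrow> int ^ 'n \<Rightarrow> 'N diff_op \<Rightarrow>
    (int ^ 'n \<Rightarrow> 'N diff_op set) set"
  where "hyp_class A \<gamma> v P = hyp_relations A \<gamma> +>\<^bsub>hyp_sum A \<gamma>\<^esub>
    direct_sum_inj (cone_lattice A) (\<lambda>v. hyp_module A (shift \<gamma> v)) v
      (hyp_ideal A (shift \<gamma> v) +>\<^bsub>weyl_module\<^esub> P)"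

interpretation hyp: module_family weyl_algebra "cone_lattice A" "\<lambda>v. hyp_module A (shift \<gamma> v)"
  for A :: "int ^ 'N::{finite,linorder} ^ 'n::finite" and \<gamma>
  by (intro module_family.intro ring_weyl_algebra left_module_hyp_module)

lemma hyp_coset_carrier:
  "hyp_ideal A \<beta> +>\<^bsub>weyl_module\<^esub> P \<in> carrier (hyp_module A \<beta>)"
  by (simp add: hyp_module_def carrier_quotient_module)

lemma hyp_module_cases:
  assumes "X \<in> carrier (hyp_module A \<beta>)"
  obtains P where "X = hyp_ideal A \<beta> +>\<^bsub>weyl_module\<^esub> P"
  using assms by (auto simp: hyp_module_def carrier_quotient_module)

text \<open>The transition maps being well defined places the relations inside the direct sum, so
  that their span is a submodule.\<close>

lemma hyp_relations_generators:
  "{direct_sum_inj (cone_lattice A) (\<lambda>v. hyp_module A (shift \<gamma> v)) i x \<ominus>\<^bsub>hyp_sum A \<gamma>\<^esub>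
      direct_sum_inj (cone_lattice A) (\<lambda>v. hyp_module A (shift \<gamma> v)) j (hyp_transition A \<gamma> i j x) |i j x.
    i \<in> cone_lattice A \<and> j \<in> cone_lattice A \<and> cone_le A i j \<and> x \<in> carrier (hyp_module A (shift \<gamma> i))}
  \<subseteq> carrier (hyp_sum A \<gamma>)"
proof -
  have "hyp_transition A \<gamma> i j x \<in> carrier (hyp_module A (shift \<gamma> j))"
    if "cone_le A i j" "x \<in> carrier (hyp_module A (shift \<gamma> i))" for i j x
    using that
    by (auto simp: cone_le_def hyp_module_def carrier_quotient_module hyp_transition_coset)
  then show ?thesis
    by (auto intro!: abelian_group.minus_closed left_module.axioms(2)[OF hyp.left_module_direct_sum]
        module_homD(1)[OF hyp.inj_hom])
qed

lemma hyp_relations_submodule: "submodule (hyp_relations A \<gamma>) weyl_algebra (hyp_sum A \<gamma>)"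
  unfolding colimit_relations_def
  by (rule submodule_span[OF hyp.left_module_direct_sum hyp_relations_generators])

lemma hyp_colimit_quotient:
  "hyp_colimit A \<gamma> = quotient_module (hyp_sum A \<gamma>) (hyp_relations A \<gamma>)"
  by (simp add: hyp_colimit_def colimit_def)

lemma left_module_hyp_colimit: "left_module weyl_algebra (hyp_colimit A \<gamma>)"
  unfolding hyp_colimit_quotient
  by (rule left_module_quotient[OF hyp.left_module_direct_sum hyp_relations_submodule])

lemma hyp_class_hom:
  assumes "v \<in> cone_lattice A"
  shows "hyp_class A \<gamma> v \<in> module_hom weyl_algebra weyl_module (hyp_colimit A \<gamma>)"
proof -
  have "(\<lambda>P. hyp_ideal A (shift \<gamma> v) +>\<^bsub>weyl_module\<^esub> P)
      \<in> module_hom weyl_algebra weyl_module (hyp_module A (shift \<gamma> v))"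
    unfolding hyp_module_def by (rule coset_hom[OF left_module_weyl hyp_ideal_submodule])
  from module_hom_comp[OF module_hom_comp[OF this hyp.inj_hom[OF assms]]
      coset_hom[OF hyp.left_module_direct_sum hyp_relations_submodule]]
  show ?thesis
    unfolding hyp_class_def[abs_def] hyp_colimit_quotient .
qed

text \<open>Derivations on the right can be absorbed into the index. Hence classes of polynomials in
  x alone, at varying indices, already generate the colimit additively.\<close>

lemma hyp_class_transition:
  assumes v: "v \<in> cone_lattice A"
  shows "hyp_class A \<gamma> (v + nat_comb A b) P = hyp_class A \<gamma> v (P * d_power b)"
proof -
  let ?u = "v + nat_comb A b"
  let ?inj = "direct_sum_inj (cone_lattice A) (\<lambda>v. hyp_module A (shift \<gamma> v))"
  let ?coset = "\<lambda>v P. hyp_ideal A (shift \<gamma> v) +>\<^bsub>weyl_module\<^esub> P"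
  have u: "?u \<in> cone_lattice A"
    by (intro cone_lattice_add v nat_comb_in_cone_lattice)
  have "cone_le A ?u v"
    by (auto simp: cone_le_def)
  then have "?inj ?u (?coset ?u P) \<ominus>\<^bsub>hyp_sum A \<gamma>\<^esub> ?inj v (hyp_transition A \<gamma> ?u v (?coset ?u P))
      \<in> hyp_relations A \<gamma>"
    unfolding colimit_relations_def
    using u v hyp_coset_carrier by (intro subsetD[OF submodule_span_incl]) blast
  moreover have "hyp_transition A \<gamma> ?u v (?coset ?u P) = ?coset v (P * d_power b)"
    by (simp add: hyp_transition_coset[where b = b] weyl_mult_d_power)
  ultimately show ?thesis
    unfolding hyp_class_def
    by (subst abelian_subgroup.coset_eq_iff[OF left_module.abelian_subgroup_submodule[OF
            hyp.left_module_direct_sum hyp_relations_submodule]])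
      (auto intro!: module_homD(1)[OF hyp.inj_hom] u v hyp_coset_carrier)
qed

lemma hyp_class_ideal:
  assumes v: "v \<in> cone_lattice A" and P: "P \<in> hyp_ideal A (shift \<gamma> v)"
  shows "hyp_class A \<gamma> v P = \<zero>\<^bsub>hyp_colimit A \<gamma>\<^esub>"
proof -
  have "hyp_class A \<gamma> v P = hyp_class A \<gamma> v 0"
    using P hyp_coset_eq_iff[of A "shift \<gamma> v" P 0] by (simp add: hyp_class_def)
  then show ?thesis
    using module_hom_zero[OF left_module_weyl left_module_hyp_colimit hyp_class_hom[OF v]] by simp
qed

section \<open>The inverse on functions\<close>

definition x_coeff :: "'k \<Rightarrow> ('N, 'k) pol \<Rightarrow> 'N::finite diff_op"
  where "x_coeff v = map_terms (\<lambda>a k c. if k = v then pmonom a 0 c else 0)"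

text \<open>All components are read off from \<open>h\<close> at once, without choosing a
  decomposition into monomials, so additivity can be checked index by index.\<close>

definition laurent_class ::
  "int ^ 'N::{finite,linorder} ^ 'n::finite \<Rightarrow> complex ^ 'n \<Rightarrow> ('N, int ^ 'n) pol \<Rightarrow>
    (int ^ 'n \<Rightarrow> 'N diff_op set) set"
  where "laurent_class A \<gamma> h = hyp_relations A \<gamma> +>\<^bsub>hyp_sum A \<gamma>\<^esub>
    (\<lambda>v\<in>cone_lattice A. hyp_ideal A (shift \<gamma> v) +>\<^bsub>weyl_module\<^esub> x_coeff v h)"

lemma x_coeff_add: "x_coeff v (p + q) = x_coeff v p + x_coeff v q"
  unfolding x_coeff_def by (rule map_terms_add) (auto simp: pmonom_add)

lemma x_coeff_monom: "x_coeff v (pmonom a k c) = (if k = v then pmonom a 0 c else 0)"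
  unfolding x_coeff_def by (rule map_terms_monom) auto

lemma x_coeff_zero: "x_coeff v 0 = 0"
  using x_coeff_add[of v 0 0] by simp

lemma hyp_coset_zero: "hyp_ideal A \<beta> +>\<^bsub>weyl_module\<^esub> 0 = hyp_ideal A \<beta>"
  using abelian_subgroup.coset_eq_subgroup_iff[OF hyp_abelian_subgroup, of 0 A \<beta>]
    submoduleD(2)[OF hyp_ideal_submodule, of A \<beta>] by simp

lemma laurent_family_monom:
  assumes "v \<in> cone_lattice A"
  shows "(\<lambda>u\<in>cone_lattice A. hyp_ideal A (shift \<gamma> u) +>\<^bsub>weyl_module\<^esub> x_coeff u (pmonom a v c)) =
    direct_sum_inj (cone_lattice A) (\<lambda>v. hyp_module A (shift \<gamma> v)) v
      (hyp_ideal A (shift \<gamma> v) +>\<^bsub>weyl_module\<^esub> pmonom a 0 c)"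
  unfolding direct_sum_inj_def
  by (intro restrict_ext) (auto simp: x_coeff_monom hyp_coset_zero hyp_module_def)

lemma laurent_family_add:
  "(\<lambda>u\<in>cone_lattice A. hyp_ideal A (shift \<gamma> u) +>\<^bsub>weyl_module\<^esub> x_coeff u (p + q)) =
    (\<lambda>u\<in>cone_lattice A. hyp_ideal A (shift \<gamma> u) +>\<^bsub>weyl_module\<^esub> x_coeff u p) \<oplus>\<^bsub>hyp_sum A \<gamma>\<^esub>
    (\<lambda>u\<in>cone_lattice A. hyp_ideal A (shift \<gamma> u) +>\<^bsub>weyl_module\<^esub> x_coeff u q)"
  unfolding direct_sum_simps
  by (intro restrict_ext)
    (simp add: x_coeff_add hyp_module_def add_coset[OF left_module_weyl hyp_ideal_submodule])

text \<open>Only finitely many powers of t occur in \<open>h\<close>, so only finitely many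
  components are nonzero; induction over the terms avoids describing the support.\<close>

lemma laurent_family_closed:
  assumes "h \<in> cone_functions A"
  shows "(\<lambda>u\<in>cone_lattice A. hyp_ideal A (shift \<gamma> u) +>\<^bsub>weyl_module\<^esub> x_coeff u h)
    \<in> carrier (hyp_sum A \<gamma>)"
  using assms
proof (induction rule: cone_functions_induct)
  case zero
  have "(\<lambda>u\<in>cone_lattice A. hyp_ideal A (shift \<gamma> u) +>\<^bsub>weyl_module\<^esub> x_coeff u 0) =
      (\<lambda>u\<in>cone_lattice A. \<zero>\<^bsub>hyp_module A (shift \<gamma> u)\<^esub>)"
    by (intro restrict_ext) (simp add: x_coeff_zero hyp_coset_zero hyp_module_def)
  then show ?case
    by (simp only: hyp.zero_in_direct_sum)
next
  case (add p q)
  then show ?case unfolding laurent_family_add by (intro hyp.add_closed)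
next
  case (monom a v c)
  then show ?case
    by (simp only: laurent_family_monom)
      (intro module_homD(1)[OF hyp.inj_hom] monom hyp_coset_carrier)
qed

lemma laurent_class_monom:
  "v \<in> cone_lattice A \<Longrightarrow> laurent_class A \<gamma> (pmonom a v c) = hyp_class A \<gamma> v (pmonom a 0 c)"
  by (simp only: laurent_class_def laurent_family_monom hyp_class_def)

lemma laurent_class_add:
  "\<lbrakk>p \<in> cone_functions A; q \<in> cone_functions A\<rbrakk> \<Longrightarrow>
    laurent_class A \<gamma> (p + q) = laurent_class A \<gamma> p \<oplus>\<^bsub>hyp_colimit A \<gamma>\<^esub> laurent_class A \<gamma> q"
  unfolding laurent_class_def laurent_family_add hyp_colimit_quotient
  by (simp add: add_coset[OF hyp.left_module_direct_sum hyp_relations_submodule] laurent_family_closed)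

lemma laurent_class_zero: "laurent_class A \<gamma> 0 = \<zero>\<^bsub>hyp_colimit A \<gamma>\<^esub>"
proof -
  have "laurent_class A \<gamma> (pmonom 0 0 0) = \<zero>\<^bsub>hyp_colimit A \<gamma>\<^esub>"
    unfolding laurent_class_monom[OF cone_lattice_zero]
    using submoduleD(2)[OF hyp_ideal_submodule]
    by (intro hyp_class_ideal cone_lattice_zero) simp
  then show ?thesis by simp
qed

lemma colimit_l_zero: "\<zero>\<^bsub>hyp_colimit A \<gamma>\<^esub> \<oplus>\<^bsub>hyp_colimit A \<gamma>\<^esub> \<zero>\<^bsub>hyp_colimit A \<gamma>\<^esub> = \<zero>\<^bsub>hyp_colimit A \<gamma>\<^esub>"
  by (intro abelian_monoid.l_zero abelian_monoid.zero_closed abelian_group.axioms(1)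
      left_module.axioms(2)[OF left_module_hyp_colimit])

lemma laurent_class_twisted:
  assumes "h \<in> cone_functions A"
  shows "laurent_class A \<gamma> (twisted_t_partial_t A \<gamma> i h) = \<zero>\<^bsub>hyp_colimit A \<gamma>\<^esub>"
  using assms
proof (induction rule: cone_functions_induct)
  case zero
  show ?case by (simp add: laurent_class_zero)
next
  case (add p q)
  then show ?case
    by (simp add: twisted_add laurent_class_add cone_functions_twisted colimit_l_zero)
next
  case (monom a v c)
  let ?c = "\<lambda>j. of_int (A $ i $ j) * c"
  let ?p = "\<lambda>j. pmonom (a + axis j 1) (v + column j A) (?c j)"
  \<comment> \<open>\<open>?p j\<close> moved from index \<open>v + column j A\<close> back to
    \<open>v\<close>, the factor t^(w_j) becoming the derivation d_j.\<close>
  let ?q = "\<lambda>j. pmonom (a + axis j 1) (axis j 1) (?c j)"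
  have v: "v + column j A \<in> cone_lattice A" for j
    by (intro cone_lattice_add monom column_in_cone_lattice)
  then have p: "?p j \<in> cone_functions A" for j
    by (rule cone_functions_monom)
  have class_p: "laurent_class A \<gamma> (?p j) = hyp_class A \<gamma> v (?q j)" for j
    using hyp_class_transition[OF monom, of \<gamma> "axis j 1" "pmonom (a + axis j 1) 0 (?c j)"]
    by (simp add: laurent_class_monom v nat_comb_axis d_power_def pmonom_mult)
  have sum: "laurent_class A \<gamma> (sum ?p S) = hyp_class A \<gamma> v (sum ?q S)" for S
  proof (induction S rule: infinite_finite_induct)
    case (insert j S)
    then show ?case
      using module_homD(2)[OF hyp_class_hom[OF monom, of \<gamma>], of "?q j" "sum ?q S"]
      by (simp add: laurent_class_add p cone_functions_sum class_p)
  qed (use laurent_class_zero hyp_class_ideal[OF monom submoduleD(2)[OF hyp_ideal_submodule]] in simp_all)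
  have "laurent_class A \<gamma> (twisted_t_partial_t A \<gamma> i (pmonom a v c)) =
      hyp_class A \<gamma> v (pmonom a 0 (shift \<gamma> v $ i * c) + sum ?q UNIV)"
    using module_homD(2)[OF hyp_class_hom[OF monom, of \<gamma>],
        of "pmonom a 0 (shift \<gamma> v $ i * c)" "sum ?q UNIV"] monom
    by (simp add: twisted_monom laurent_class_add cone_functions_monom cone_functions_sum p sum
        laurent_class_monom)
  \<comment> \<open>With x^a on the left, composition equals the product of symbols, so the sum is a
    left multiple of the Euler operator at \<open>v\<close>.\<close>
  also have "pmonom a 0 (shift \<gamma> v $ i * c) + sum ?q UNIV =
      pmonom a 0 c \<star> euler_op A (shift \<gamma> v) i"
    by (simp add: x_weyl_mult euler_op_monoms distrib_left sum_distrib_left pmonom_mult ac_simps)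
  also have "hyp_class A \<gamma> v \<dots> = \<zero>\<^bsub>hyp_colimit A \<gamma>\<^esub>"
    by (intro hyp_class_ideal monom hyp_ideal_left euler_in_hyp_ideal)
  finally show ?case .
qed

text \<open>A derivation raises the exponent of t on one side and is absorbed into the index by
  \<open>hyp_class_transition\<close> on the other. Thus the function P . t^v remembers the class of
  \<open>P\<close> in the colimit.\<close>

lemma laurent_class_act:
  assumes v: "v \<in> cone_lattice A"
  shows "laurent_class A \<gamma> (act (\<lambda>j. column j A) P (pmonom 0 v 1)) = hyp_class A \<gamma> v P"
proof (induction P rule: pol_induct)
  case zero
  show ?case
    using laurent_class_zero hyp_class_ideal[OF v submoduleD(2)[OF hyp_ideal_submodule]] by simp
next
  case (add P Q)
  then show ?case
    using module_homD(2)[OF hyp_class_hom[OF v, of \<gamma>], of P Q] v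
    by (simp add: act_add_left laurent_class_add cone_functions_act cone_functions_monom)
next
  case (monom a b c)
  show ?case
    using hyp_class_transition[OF v, of \<gamma> b "pmonom a 0 c"]
    by (simp add: act_monom_monom laurent_class_monom cone_lattice_add v nat_comb_in_cone_lattice
        d_power_def pmonom_mult)
qed

section \<open>Comparison of the direct sum with the cohomology\<close>

definition colimit_to_cohomology ::
  "int ^ 'N::{finite,linorder} ^ 'n::{finite,linorder} \<Rightarrow> complex ^ 'n::{finite,linorder} \<Rightarrow>
    (int ^ 'n::{finite,linorder} \<Rightarrow> 'N diff_op set) \<Rightarrow>
    ('n set \<Rightarrow> ('N, int ^ 'n::{finite,linorder}) pol) set"
  where "colimit_to_cohomology A \<gamma> =
    direct_sum_lift (cone_lattice A) (\<lambda>v. hyp_module A (shift \<gamma> v)) (top_cohomology A \<gamma>)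
      (\<lambda>v. induced_map (act_on_monomial A \<gamma> v))"

lemma induced_act_hom:
  "v \<in> cone_lattice A \<Longrightarrow> induced_map (act_on_monomial A \<gamma> v)
    \<in> module_hom weyl_algebra (hyp_module A (shift \<gamma> v)) (top_cohomology A \<gamma>)"
  unfolding hyp_module_def
  by (rule induced_map_hom[OF left_module_weyl left_module_top_cohomology act_on_monomial_hom
        hyp_ideal_submodule act_on_monomial_ideal])

lemma colimit_to_cohomology_hom:
  "colimit_to_cohomology A \<gamma> \<in> module_hom weyl_algebra (hyp_sum A \<gamma>) (top_cohomology A \<gamma>)"
  unfolding colimit_to_cohomology_def
  by (rule hyp.direct_sum_lift_hom[OF left_module_top_cohomology induced_act_hom])

lemma colimit_to_cohomology_inj:
  assumes v: "v \<in> cone_lattice A"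
  shows "colimit_to_cohomology A \<gamma> (direct_sum_inj (cone_lattice A) (\<lambda>v. hyp_module A (shift \<gamma> v)) v
    (hyp_ideal A (shift \<gamma> v) +>\<^bsub>weyl_module\<^esub> P)) = act_on_monomial A \<gamma> v P"
proof -
  have "induced_map (act_on_monomial A \<gamma> v) (hyp_ideal A (shift \<gamma> v) +>\<^bsub>weyl_module\<^esub> P) =
      act_on_monomial A \<gamma> v P"
    by (rule induced_map_coset[OF left_module_weyl left_module_top_cohomology act_on_monomial_hom[OF v]
        hyp_ideal_submodule act_on_monomial_ideal[OF v]]) auto
  then show ?thesis
    unfolding colimit_to_cohomology_def
    by (simp add: hyp.direct_sum_lift_inj[OF left_module_top_cohomology induced_act_hom v]
        hyp_coset_carrier)
qed

lemma top_form_coset_add: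
  fixes A :: "int ^ 'N::{finite,linorder} ^ 'n::{finite,linorder}"
  assumes "p \<in> cone_functions A" "q \<in> cone_functions A"
  shows "exact_forms A \<gamma> +>\<^bsub>log_forms A CARD('n)\<^esub> top_form (p + q) =
    (exact_forms A \<gamma> +>\<^bsub>log_forms A CARD('n)\<^esub> top_form p) \<oplus>\<^bsub>top_cohomology A \<gamma>\<^esub>
    (exact_forms A \<gamma> +>\<^bsub>log_forms A CARD('n)\<^esub> top_form q)"
proof -
  have "top_form (p + q) = top_form p \<oplus>\<^bsub>log_forms A CARD('n)\<^esub> top_form q"
    by (auto simp: log_forms_simps top_form_def)
  then show ?thesis
    unfolding top_cohomology_def
    using assms by (simp add: add_coset[OF left_module_log_forms exact_forms_submodule]
        top_form_in_log_forms)
qed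

text \<open>Without directedness \<open>f\<close> cannot in general be pushed into one component. A
  single function replaces the common representative: it describes the image in cohomology and the
  class in the colimit simultaneously.\<close>

lemma hyp_sum_laurent_representative:
  fixes A :: "int ^ 'N::{finite,linorder} ^ 'n::{finite,linorder}"
  assumes "f \<in> carrier (hyp_sum A \<gamma>)"
  shows "\<exists>h\<in>cone_functions A.
    colimit_to_cohomology A \<gamma> f = exact_forms A \<gamma> +>\<^bsub>log_forms A CARD('n)\<^esub> top_form h \<and>
    hyp_relations A \<gamma> +>\<^bsub>hyp_sum A \<gamma>\<^esub> f = laurent_class A \<gamma> h"
  using assms
proof (induction f rule: hyp.direct_sum_induct)
  case zero
  have "colimit_to_cohomology A \<gamma> \<zero>\<^bsub>hyp_sum A \<gamma>\<^esub> = \<zero>\<^bsub>top_cohomology A \<gamma>\<^esub>"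
    by (rule module_hom_zero[OF hyp.left_module_direct_sum left_module_top_cohomology
          colimit_to_cohomology_hom])
  moreover have "hyp_relations A \<gamma> +>\<^bsub>hyp_sum A \<gamma>\<^esub> \<zero>\<^bsub>hyp_sum A \<gamma>\<^esub> = \<zero>\<^bsub>hyp_colimit A \<gamma>\<^esub>"
    unfolding hyp_colimit_quotient
    by (rule module_hom_zero[OF hyp.left_module_direct_sum _
          coset_hom[OF hyp.left_module_direct_sum hyp_relations_submodule]])
      (rule left_module_quotient[OF hyp.left_module_direct_sum hyp_relations_submodule])
  ultimately show ?case
    by (intro bexI[of _ 0]) (simp_all add: laurent_class_zero top_form_coset_zero)
next
  case (inj v X)
  then obtain P where X: "X = hyp_ideal A (shift \<gamma> v) +>\<^bsub>weyl_module\<^esub> P"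
    by (elim hyp_module_cases)
  show ?case
    using inj(1)
    \<comment> \<open>The witness P . t^v is the function that defines
      \<open>act_on_monomial\<close>, and \<open>laurent_class_act\<close> returns it to the class
      of \<open>P\<close>.\<close>
    by (intro bexI[of _ "act (\<lambda>j. column j A) P (pmonom 0 v 1)"])
      (simp_all add: X colimit_to_cohomology_inj act_on_monomial_def laurent_class_act
        cone_functions_act cone_functions_monom flip: hyp_class_def)
next
  case (add f g)
  then obtain h k where hk: "h \<in> cone_functions A" "k \<in> cone_functions A"
    "colimit_to_cohomology A \<gamma> f = exact_forms A \<gamma> +>\<^bsub>log_forms A CARD('n)\<^esub> top_form h"
    "colimit_to_cohomology A \<gamma> g = exact_forms A \<gamma> +>\<^bsub>log_forms A CARD('n)\<^esub> top_form k"
    "hyp_relations A \<gamma> +>\<^bsub>hyp_sum A \<gamma>\<^esub> f = laurent_class A \<gamma> h"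
    "hyp_relations A \<gamma> +>\<^bsub>hyp_sum A \<gamma>\<^esub> g = laurent_class A \<gamma> k"
    by blast
  have "hyp_relations A \<gamma> +>\<^bsub>hyp_sum A \<gamma>\<^esub> (f \<oplus>\<^bsub>hyp_sum A \<gamma>\<^esub> g) = laurent_class A \<gamma> (h + k)"
    using add.hyps hk
    by (simp add: laurent_class_add hyp_colimit_quotient
        flip: add_coset[OF hyp.left_module_direct_sum hyp_relations_submodule])
  then show ?case
    using add.hyps hk
    by (intro bexI[of _ "h + k"])
      (simp_all add: top_form_coset_add module_homD(2)[OF colimit_to_cohomology_hom] cone_functions_add)
qed

lemma colimit_to_cohomology_surj:
  fixes A :: "int ^ 'N::{finite,linorder} ^ 'n::{finite,linorder}"
  assumes "h \<in> cone_functions A"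
  shows "\<exists>f\<in>carrier (hyp_sum A \<gamma>).
    colimit_to_cohomology A \<gamma> f = exact_forms A \<gamma> +>\<^bsub>log_forms A CARD('n)\<^esub> top_form h"
  using assms
proof (induction rule: cone_functions_induct)
  case zero
  have "\<zero>\<^bsub>hyp_sum A \<gamma>\<^esub> \<in> carrier (hyp_sum A \<gamma>)"
    by (simp only: direct_sum_simps(1) hyp.zero_in_direct_sum)
  moreover have "colimit_to_cohomology A \<gamma> \<zero>\<^bsub>hyp_sum A \<gamma>\<^esub> = \<zero>\<^bsub>top_cohomology A \<gamma>\<^esub>"
    by (rule module_hom_zero[OF hyp.left_module_direct_sum left_module_top_cohomology
          colimit_to_cohomology_hom])
  ultimately show ?case
    unfolding top_form_coset_zero by blast
next
  case (add p q)
  then obtain f g where "f \<in> carrier (hyp_sum A \<gamma>)" "g \<in> carrier (hyp_sum A \<gamma>)"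
    "colimit_to_cohomology A \<gamma> f = exact_forms A \<gamma> +>\<^bsub>log_forms A CARD('n)\<^esub> top_form p"
    "colimit_to_cohomology A \<gamma> g = exact_forms A \<gamma> +>\<^bsub>log_forms A CARD('n)\<^esub> top_form q"
    by blast
  with add.hyps show ?case
    by (intro bexI[of _ "f \<oplus>\<^bsub>hyp_sum A \<gamma>\<^esub> g"])
      (simp_all add: top_form_coset_add module_homD(2)[OF colimit_to_cohomology_hom] hyp.add_closed)
next
  case (monom a v c)
  \<comment> \<open>x^a t^v comes from x^a at index \<open>v\<close>, which is available because the
    exponent lies in the cone.\<close>
  have "act (\<lambda>j. column j A) (pmonom a 0 c) (pmonom 0 v 1) = pmonom a v c"
    by (simp add: act_monom_monom nat_comb_zero)
  then have "colimit_to_cohomology A \<gamma>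
      (direct_sum_inj (cone_lattice A) (\<lambda>v. hyp_module A (shift \<gamma> v)) v
        (hyp_ideal A (shift \<gamma> v) +>\<^bsub>weyl_module\<^esub> pmonom a 0 c)) =
      exact_forms A \<gamma> +>\<^bsub>log_forms A CARD('n)\<^esub> top_form (pmonom a v c)"
    by (simp only: colimit_to_cohomology_inj monom act_on_monomial_def)
  then show ?case
    using module_homD(1)[OF hyp.inj_hom[OF monom] hyp_coset_carrier] by blast
qed

text \<open>Exactness of the representing function is carried back: a sum of values of the D_i has
  class zero by \<open>laurent_class_twisted\<close>, so \<open>f\<close> represents zero in the
  colimit.\<close>

lemma colimit_to_cohomology_kernel:
  fixes A :: "int ^ 'N::{finite,linorder} ^ 'n::{finite,linorder}"
  assumes f: "f \<in> carrier (hyp_sum A \<gamma>)" "colimit_to_cohomology A \<gamma> f = \<zero>\<^bsub>top_cohomology A \<gamma>\<^esub>"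
  shows "f \<in> hyp_relations A \<gamma>"
proof -
  obtain h where h: "h \<in> cone_functions A"
    "colimit_to_cohomology A \<gamma> f = exact_forms A \<gamma> +>\<^bsub>log_forms A CARD('n)\<^esub> top_form h"
    "hyp_relations A \<gamma> +>\<^bsub>hyp_sum A \<gamma>\<^esub> f = laurent_class A \<gamma> h"
    using hyp_sum_laurent_representative[OF f(1)] by blast
  then have "top_form h \<in> exact_forms A \<gamma>"
    using f(2) by (simp flip: top_form_coset_zero_iff)
  then obtain H where H: "\<And>i. H i \<in> cone_functions A"
    "h = (\<Sum>i\<in>UNIV. twisted_t_partial_t A \<gamma> i (H i))"
    using exact_top_form_decomp by blast
  have "laurent_class A \<gamma> (\<Sum>i\<in>S. twisted_t_partial_t A \<gamma> i (H i)) = \<zero>\<^bsub>hyp_colimit A \<gamma>\<^esub>" for S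
    by (induction S rule: infinite_finite_induct)
      (simp_all add: laurent_class_zero laurent_class_add laurent_class_twisted H(1)
        cone_functions_sum cone_functions_twisted colimit_l_zero)
  with H(2) h(3) have "hyp_relations A \<gamma> +>\<^bsub>hyp_sum A \<gamma>\<^esub> f = hyp_relations A \<gamma>"
    by (simp add: hyp_colimit_quotient)
  then show ?thesis
    using abelian_subgroup.coset_eq_subgroup_iff[OF left_module.abelian_subgroup_submodule[OF
          hyp.left_module_direct_sum hyp_relations_submodule] f(1)] by simp
qed

lemma colimit_to_cohomology_relations:
  fixes A :: "int ^ 'N::{finite,linorder} ^ 'n::{finite,linorder}"
  assumes "f \<in> hyp_relations A \<gamma>"
  shows "colimit_to_cohomology A \<gamma> f = \<zero>\<^bsub>top_cohomology A \<gamma>\<^esub>"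
proof -
  let ?inj = "direct_sum_inj (cone_lattice A) (\<lambda>v. hyp_module A (shift \<gamma> v))"
  let ?K = "{f \<in> carrier (hyp_sum A \<gamma>). colimit_to_cohomology A \<gamma> f = \<zero>\<^bsub>top_cohomology A \<gamma>\<^esub>}"
  interpret hom: abelian_group_hom "hyp_sum A \<gamma>" "top_cohomology A \<gamma>" "colimit_to_cohomology A \<gamma>"
    using colimit_to_cohomology_hom[of A \<gamma>]
    by (intro abelian_group_hom_if_additive left_module.axioms(2)[OF hyp.left_module_direct_sum]
        left_module.axioms(2)[OF left_module_top_cohomology]) (auto simp: module_hom_def)
  have "hyp_relations A \<gamma> \<subseteq> ?K"
    unfolding colimit_relations_def
  proof (rule submodule_span_minimal)
    show "submodule ?K weyl_algebra (hyp_sum A \<gamma>)"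
      by (rule left_module.submodule_kernel[OF hyp.left_module_direct_sum left_module_top_cohomology
            colimit_to_cohomology_hom])
    have "colimit_to_cohomology A \<gamma> (?inj u X \<ominus>\<^bsub>hyp_sum A \<gamma>\<^esub> ?inj v (hyp_transition A \<gamma> u v X)) =
        \<zero>\<^bsub>top_cohomology A \<gamma>\<^esub>"
      if u: "u \<in> cone_lattice A" and v: "v \<in> cone_lattice A" and le: "cone_le A u v"
        and X: "X \<in> carrier (hyp_module A (shift \<gamma> u))" for u v X
    proof -
      obtain b where b: "u - v = nat_comb A b"
        using le by (auto simp: cone_le_def)
      then have u_eq: "u = v + nat_comb A b" by (simp add: algebra_simps)
      obtain P where P: "X = hyp_ideal A (shift \<gamma> u) +>\<^bsub>weyl_module\<^esub> P"
        using X by (rule hyp_module_cases)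
      \<comment> \<open>The transition from \<open>u\<close> to \<open>v\<close> multiplies by
        \<open>d_power b\<close> on the right, and \<open>d_power b\<close> takes t^v to t^u;
        compatibility is then associativity of the action.\<close>
      have "act (\<lambda>j. column j A) (d_power b) (pmonom 0 v 1) = pmonom 0 u 1"
        by (simp add: d_power_def act_monom_monom u_eq)
      then have eq: "act_on_monomial A \<gamma> v (P \<star> d_power b) = act_on_monomial A \<gamma> u P"
        by (simp add: act_on_monomial_def act_weyl_mult)
      have carrier: "?inj w (hyp_ideal A (shift \<gamma> w) +>\<^bsub>weyl_module\<^esub> Q) \<in> carrier (hyp_sum A \<gamma>)"
        if "w \<in> cone_lattice A" for w Q
        by (rule module_homD(1)[OF hyp.inj_hom[OF that] hyp_coset_carrier])
      have "act_on_monomial A \<gamma> u P \<in> carrier (top_cohomology A \<gamma>)"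
        using module_homD(1)[OF act_on_monomial_hom[OF u]] by simp
      then show ?thesis
        by (simp add: P hyp_transition_coset[OF b] hom.G.minus_eq carrier u v
            colimit_to_cohomology_inj eq hom.H.r_neg)
    qed
    then show "{?inj i x \<ominus>\<^bsub>hyp_sum A \<gamma>\<^esub> ?inj j (hyp_transition A \<gamma> i j x) |i j x.
        i \<in> cone_lattice A \<and> j \<in> cone_lattice A \<and> cone_le A i j \<and>
        x \<in> carrier (hyp_module A (shift \<gamma> i))} \<subseteq> ?K"
      using hyp_relations_generators[of A \<gamma>] by blast
  qed
  with assms show ?thesis by blast
qed

declare One_nat_def [simp]

theorem proposition0p11:
  fixes A :: "int ^ 'N::{finite,linorder} ^ 'n::{finite,linorder}" and \<gamma> :: "complex ^ 'n::{finite,linorder}"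
  assumes "rank (\<chi> i j. real_of_int (A $ i $ j)) = CARD('n::{finite,linorder})"
  shows "module_isomorphic weyl_algebra
    (hyp_colimit A \<gamma>) (cohomology (log_forms A) (log_d A \<gamma>) CARD('n::{finite,linorder}))"
  unfolding cohomology_top hyp_colimit_quotient
proof (rule quotient_isomorphic[OF hyp.left_module_direct_sum left_module_top_cohomology
      colimit_to_cohomology_hom _ hyp_relations_submodule])
  have "Y \<in> colimit_to_cohomology A \<gamma> ` carrier (hyp_sum A \<gamma>)"
    if Y: "Y \<in> carrier (top_cohomology A \<gamma>)" for Y
  proof -
    obtain \<omega> where "\<omega> \<in> carrier (log_forms A CARD('n))"
      "Y = exact_forms A \<gamma> +>\<^bsub>log_forms A CARD('n)\<^esub> \<omega>"
      using Y by (auto simp: top_cohomology_def carrier_quotient_module)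
    then show ?thesis
      using log_forms_top[of \<omega> A] colimit_to_cohomology_surj[of "\<omega> UNIV" A \<gamma>] by auto
  qed
  then show "colimit_to_cohomology A \<gamma> ` carrier (hyp_sum A \<gamma>) = carrier (top_cohomology A \<gamma>)"
    using module_homD(1)[OF colimit_to_cohomology_hom[of A \<gamma>]] by blast
  \<comment> \<open>The homomorphism lives on the direct sum, so one direction is its descent to the
    colimit and the other is injectivity there.\<close>
  show "colimit_to_cohomology A \<gamma> f = \<zero>\<^bsub>top_cohomology A \<gamma>\<^esub> \<longleftrightarrow> f \<in> hyp_relations A \<gamma>"
    if "f \<in> carrier (hyp_sum A \<gamma>)" for f
    using that colimit_to_cohomology_kernel colimit_to_cohomology_relations by blast
qed

end
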